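(* Let $V$ be a finite-dimensional vector space over an algebraically closed field $k$. Suppose that an algebraic subvariety $X\subset V$ is irreducible, is not contained in a homogeneous hyperplane, meets every homogeneous hyperplane (i.e. $X\cap H\neq\emptyset$ for every homogeneous hyperplane $H\subset V$), and $\dim X>1$. Then $Ch(X)$ and $Chw(X)$ are closed in $\mathbb{P}(V^* )\times\mathbb{P}(V^* )$.
   Context: A homogeneous hyperplane in $V$ is a linear subspace of codimension one. For nonzero $\alpha\in V^*$, $\langle\alpha\rangle\in\mathbb{P}(V^* )$ denotes the corresponding point. For a subset $X\subset V$, the characteristic variety is $$Ch(X)=\{(\langle\alpha\rangle,\langle\beta\rangle)\in\mathbb{P}(V^* )\times\mathbb{P}(V^* )\mid \text{for all } x\in X:\ \alpha(x)=0\Rightarrow\beta(x)=0\},$$ and the weak characteristic variety is $$Chw(X)=\{(\langle\alpha\rangle,\langle\beta\rangle)\in\mathbb{P}(V^* )\times\mathbb{P}(V^* )\mid \text{for all } x\in X:\ \alpha(x)=0\Leftrightarrow\beta(x)=0\}.$$ Closed means Zariski closed. *)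

theory Defs
  imports
    "HOL-Analysis.Abstract_Topology"
    "HOL-Computational_Algebra.Polynomial"
    "HOL-Library.Extended_Nat"
begin

section \<open>Irreducibility and dimension of topological spaces\<close>

definition irreducible_space :: "'a topology \<Rightarrow> bool" where
  "irreducible_space T \<longleftrightarrow>
     topspace T \<noteq> {} \<and>
     (\<forall>A B. closedin T A \<and> closedin T B \<and> A \<union> B = topspace T \<longrightarrow>
        A = topspace T \<or> B = topspace T)"

definition locally_closedin :: "'a topology \<Rightarrow> 'a set \<Rightarrow> bool" where
  "locally_closedin T X \<longleftrightarrow> (\<exists>U C. openin T U \<and> closedin T C \<and> X = U \<inter> C)"

text \<open>
  The Krull dimension: the supremum of the lengths \<open>n\<close> of strictly increasing chains
  \<open>C 0 \<subset> \<dots> \<subset> C n\<close> of irreducible closed subsets. (The empty space gets dimension \<open>0\<close>.)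
\<close>

definition krull_dim :: "'a topology \<Rightarrow> enat" where
  "krull_dim T = Sup {enat n | n. \<exists>C :: nat \<Rightarrow> 'a set.
     (\<forall>i\<le>n. closedin T (C i) \<and> irreducible_space (subtopology T (C i))) \<and>
     (\<forall>i<n. C i \<subset> C (Suc i))}"

lemma istopology_basic_opens:
  assumes "\<And>f g. f \<in> P \<Longrightarrow> g \<in> P \<Longrightarrow> \<exists>h\<in>P. D h = D f \<inter> D g"
  shows "istopology (\<lambda>U. \<exists>F\<subseteq>P. U = (\<Union>f\<in>F. D f))"
  unfolding istopology_def
proof (intro conjI allI impI)
  fix S T
  assume "\<exists>F\<subseteq>P. S = (\<Union>f\<in>F. D f)" "\<exists>F\<subseteq>P. T = (\<Union>f\<in>F. D f)"
  then obtain F G where FG: "F \<subseteq> P" "S = (\<Union>f\<in>F. D f)" "G \<subseteq> P" "T = (\<Union>f\<in>G. D f)"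
    by blast
  obtain h where h: "\<And>f g. f \<in> P \<Longrightarrow> g \<in> P \<Longrightarrow> h f g \<in> P \<and> D (h f g) = D f \<inter> D g"
    using assms by metis
  have "S \<inter> T = (\<Union>k \<in> {h f g | f g. f \<in> F \<and> g \<in> G}. D k)"
  proof (intro equalityI subsetI)
    fix x assume "x \<in> S \<inter> T"
    then obtain f g where "f \<in> F" "g \<in> G" "x \<in> D f \<inter> D g" using FG(2,4) by blast
    moreover from this have "x \<in> D (h f g)" using h FG(1,3) by blast
    ultimately show "x \<in> (\<Union>k \<in> {h f g | f g. f \<in> F \<and> g \<in> G}. D k)" by blast
  next
    fix x assume "x \<in> (\<Union>k \<in> {h f g | f g. f \<in> F \<and> g \<in> G}. D k)"
    then obtain f g where fg: "f \<in> F" "g \<in> G" "x \<in> D (h f g)" by blast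
    then have "x \<in> D f \<inter> D g" using h[of f g] FG(1,3) by blast
    then show "x \<in> S \<inter> T" using fg(1,2) FG(2,4) by blast
  qed
  moreover have "{h f g | f g. f \<in> F \<and> g \<in> G} \<subseteq> P" using h FG(1,3) by blast
  ultimately show "\<exists>F\<subseteq>P. S \<inter> T = (\<Union>f\<in>F. D f)" by blast
next
  fix K
  assume "\<forall>S\<in>K. \<exists>F\<subseteq>P. S = (\<Union>f\<in>F. D f)"
  then obtain F where F: "\<And>S. S \<in> K \<Longrightarrow> F S \<subseteq> P \<and> S = (\<Union>f\<in>F S. D f)" by metis
  have "\<Union>K = (\<Union>S\<in>K. \<Union>f\<in>F S. D f)"
    using F by (metis (no_types, lifting) SUP_cong image_ident)
  then have "\<Union>K = (\<Union>f\<in>(\<Union>S\<in>K. F S). D f)" by blast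
  moreover have "(\<Union>S\<in>K. F S) \<subseteq> P" using F by blast
  ultimately show "\<exists>F\<subseteq>P. \<Union>K = (\<Union>f\<in>F. D f)" by blast
qed

section \<open>Affine space\<close>

text \<open>
  Throughout, a vector space \<open>V\<close> is the universe of a type \<open>'v\<close> with scalar
  multiplication \<open>scale\<close>.
\<close>

definition dual :: "('k::field \<Rightarrow> 'v::ab_group_add \<Rightarrow> 'v) \<Rightarrow> ('v \<Rightarrow> 'k) set" where
  "dual scale = {\<alpha>. Vector_Spaces.linear scale (*) \<alpha>}"

definition homogeneous_hyperplane ::
  "('k::field \<Rightarrow> 'v::ab_group_add \<Rightarrow> 'v) \<Rightarrow> 'v set \<Rightarrow> bool" where
  "homogeneous_hyperplane scale H \<longleftrightarrow>
     module.subspace scale H \<and>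
     vector_space.dim scale H + 1 = vector_space.dim scale UNIV"

text \<open>The coordinate ring \<open>k[V]\<close>: the algebra of functions generated by the linear functionals.\<close>

inductive_set polyfuns :: "('k::field \<Rightarrow> 'v::ab_group_add \<Rightarrow> 'v) \<Rightarrow> ('v \<Rightarrow> 'k) set"
  for scale where
  const: "(\<lambda>_. c) \<in> polyfuns scale"
| functional: "\<alpha> \<in> dual scale \<Longrightarrow> \<alpha> \<in> polyfuns scale"
| add: "f \<in> polyfuns scale \<Longrightarrow> g \<in> polyfuns scale \<Longrightarrow> (\<lambda>x. f x + g x) \<in> polyfuns scale"
| mult: "f \<in> polyfuns scale \<Longrightarrow> g \<in> polyfuns scale \<Longrightarrow> (\<lambda>x. f x * g x) \<in> polyfuns scale"

definition zariski :: "('k::field \<Rightarrow> 'v::ab_group_add \<Rightarrow> 'v) \<Rightarrow> 'v topology" where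
  "zariski scale = topology (\<lambda>U. \<exists>F \<subseteq> polyfuns scale. U = (\<Union>f\<in>F. {x. f x \<noteq> 0}))"

lemma openin_zariski:
  "openin (zariski scale) U \<longleftrightarrow> (\<exists>F \<subseteq> polyfuns scale. U = (\<Union>f\<in>F. {x. f x \<noteq> 0}))"
proof -
  have "istopology (\<lambda>U. \<exists>F \<subseteq> polyfuns scale. U = (\<Union>f\<in>F. {x. f x \<noteq> 0}))"
  proof (rule istopology_basic_opens)
    fix f g assume "f \<in> polyfuns scale" "g \<in> polyfuns scale"
    then show "\<exists>h\<in>polyfuns scale. {x. h x \<noteq> 0} = {x. f x \<noteq> 0} \<inter> {x. g x \<noteq> 0}"
      by (intro bexI[OF _ polyfuns.mult[of f scale g]]) auto
  qed
  then show ?thesis by (simp add: zariski_def topology_inverse')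
qed

lemma topspace_zariski [simp]: "topspace (zariski scale) = UNIV"
proof -
  have "openin (zariski scale) UNIV"
    unfolding openin_zariski
    by (intro exI[of _ "{\<lambda>_. 1}"]) (auto intro: polyfuns.const)
  then show ?thesis using openin_subset by blast
qed

lemma closedin_zariski:
  "closedin (zariski scale) C \<longleftrightarrow> (\<exists>F \<subseteq> polyfuns scale. C = {x. \<forall>f\<in>F. f x = 0})"
proof -
  have "UNIV - C = (\<Union>f\<in>F. {x. f x \<noteq> 0}) \<longleftrightarrow> C = {x. \<forall>f\<in>F. f x = 0}" for F :: "('a \<Rightarrow> 'b) set"
    by blast
  then show ?thesis by (simp add: closedin_def openin_zariski)
qed

text \<open>
  Subvarieties need not be closed and need not be irreducible; in particular all Zariski closed
  subsets of \<open>V\<close> are subvarieties.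
\<close>

definition algebraic_subvariety ::
  "('k::field \<Rightarrow> 'v::ab_group_add \<Rightarrow> 'v) \<Rightarrow> 'v set \<Rightarrow> bool" where
  "algebraic_subvariety scale X \<longleftrightarrow> locally_closedin (zariski scale) X"

lemma closedin_imp_algebraic_subvariety:
  "closedin (zariski scale) X \<Longrightarrow> algebraic_subvariety scale X"
  unfolding algebraic_subvariety_def locally_closedin_def
  by (metis inf_top_left openin_topspace topspace_zariski)

section \<open>The product of two copies of the dual projective space\<close>

definition nonzero_dual :: "('k::field \<Rightarrow> 'v::ab_group_add \<Rightarrow> 'v) \<Rightarrow> ('v \<Rightarrow> 'k) set" where
  "nonzero_dual scale = dual scale - {\<lambda>_. 0}"

text \<open>Points of \<open>P(V\<^sup>*)\<close> are lines in \<open>V\<^sup>*\<close>.\<close>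

definition proj_point :: "('v \<Rightarrow> 'k::field) \<Rightarrow> ('v \<Rightarrow> 'k) set" where
  "proj_point \<alpha> = {(\<lambda>x. c * \<alpha> x) | c. True}"

definition proj_dual :: "('k::field \<Rightarrow> 'v::ab_group_add \<Rightarrow> 'v) \<Rightarrow> ('v \<Rightarrow> 'k) set set" where
  "proj_dual scale = proj_point ` nonzero_dual scale"

text \<open>
  Bihomogeneous polynomial functions of bidegree \<open>(d, e)\<close> on \<open>V\<^sup>* \<times> V\<^sup>*\<close>. The coordinate
  functions on \<open>V\<^sup>*\<close> are the evaluations at vectors, since \<open>V\<close> is finite-dimensional.
\<close>

inductive bihom :: "nat \<Rightarrow> nat \<Rightarrow> (('v \<Rightarrow> 'k::field) \<Rightarrow> ('v \<Rightarrow> 'k) \<Rightarrow> 'k) \<Rightarrow> bool" where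
  const: "bihom 0 0 (\<lambda>\<alpha> \<beta>. c)"
| eval1: "bihom 1 0 (\<lambda>\<alpha> \<beta>. \<alpha> v)"
| eval2: "bihom 0 1 (\<lambda>\<alpha> \<beta>. \<beta> v)"
| add: "bihom d e f \<Longrightarrow> bihom d e g \<Longrightarrow> bihom d e (\<lambda>\<alpha> \<beta>. f \<alpha> \<beta> + g \<alpha> \<beta>)"
| mult: "bihom d e f \<Longrightarrow> bihom d' e' g \<Longrightarrow> bihom (d + d') (e + e') (\<lambda>\<alpha> \<beta>. f \<alpha> \<beta> * g \<alpha> \<beta>)"

definition bihoms :: "(('v \<Rightarrow> 'k::field) \<Rightarrow> ('v \<Rightarrow> 'k) \<Rightarrow> 'k) set" where
  "bihoms = {f. \<exists>d e. bihom d e f}"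

definition nonvanishing ::
  "('k::field \<Rightarrow> 'v::ab_group_add \<Rightarrow> 'v) \<Rightarrow> (('v \<Rightarrow> 'k) \<Rightarrow> ('v \<Rightarrow> 'k) \<Rightarrow> 'k) \<Rightarrow>
    (('v \<Rightarrow> 'k) set \<times> ('v \<Rightarrow> 'k) set) set" where
  "nonvanishing scale f =
     {(proj_point \<alpha>, proj_point \<beta>) | \<alpha> \<beta>.
        \<alpha> \<in> nonzero_dual scale \<and> \<beta> \<in> nonzero_dual scale \<and> f \<alpha> \<beta> \<noteq> 0}"

text \<open>
  The Zariski topology of the variety \<open>P(V\<^sup>*) \<times> P(V\<^sup>*)\<close>; this is finer than the
  product of the two Zariski topologies.
\<close>

definition zariski_proj2 ::
  "('k::field \<Rightarrow> 'v::ab_group_add \<Rightarrow> 'v) \<Rightarrow> (('v \<Rightarrow> 'k) set \<times> ('v \<Rightarrow> 'k) set) topology" where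
  "zariski_proj2 scale =
     topology (\<lambda>U. \<exists>F \<subseteq> bihoms. U = (\<Union>f\<in>F. nonvanishing scale f))"

lemma bihom_scale:
  "bihom d e f \<Longrightarrow> f (\<lambda>x. a * \<alpha> x) (\<lambda>x. b * \<beta> x) = a ^ d * b ^ e * f \<alpha> \<beta>"
  by (induction rule: bihom.induct) (auto simp: algebra_simps power_add)

lemma proj_point_eqD:
  assumes "proj_point \<alpha> = proj_point \<alpha>'" "\<alpha> \<noteq> (\<lambda>_. 0)"
  shows "\<exists>c. c \<noteq> 0 \<and> \<alpha> = (\<lambda>x. c * \<alpha>' x)"
proof -
  have "\<alpha> \<in> proj_point \<alpha>"
    unfolding proj_point_def by (auto intro!: exI[of _ 1])
  then obtain c where "\<alpha> = (\<lambda>x. c * \<alpha>' x)"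
    using assms(1) by (auto simp: proj_point_def)
  then show ?thesis using assms(2) by force
qed

lemma nonvanishing_iff:
  assumes "f \<in> bihoms" "\<alpha> \<in> nonzero_dual scale" "\<beta> \<in> nonzero_dual scale"
  shows "(proj_point \<alpha>, proj_point \<beta>) \<in> nonvanishing scale f \<longleftrightarrow> f \<alpha> \<beta> \<noteq> 0"
proof
  assume "(proj_point \<alpha>, proj_point \<beta>) \<in> nonvanishing scale f"
  then obtain \<alpha>' \<beta>' where *: "proj_point \<alpha> = proj_point \<alpha>'" "proj_point \<beta> = proj_point \<beta>'"
      "f \<alpha>' \<beta>' \<noteq> 0"
    unfolding nonvanishing_def by blast
  obtain a b where "a \<noteq> 0" "\<alpha> = (\<lambda>x. a * \<alpha>' x)" "b \<noteq> 0" "\<beta> = (\<lambda>x. b * \<beta>' x)"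
    using proj_point_eqD[OF *(1)] proj_point_eqD[OF *(2)] assms(2,3)
    by (auto simp: nonzero_dual_def)
  moreover obtain d e where "bihom d e f" using assms(1) by (auto simp: bihoms_def)
  ultimately show "f \<alpha> \<beta> \<noteq> 0" using *(3) by (simp add: bihom_scale)
qed (use assms in \<open>auto simp: nonvanishing_def\<close>)

lemma nonvanishing_subset: "nonvanishing scale f \<subseteq> proj_dual scale \<times> proj_dual scale"
  by (auto simp: nonvanishing_def proj_dual_def)

lemma openin_zariski_proj2:
  "openin (zariski_proj2 scale) U \<longleftrightarrow> (\<exists>F \<subseteq> bihoms. U = (\<Union>f\<in>F. nonvanishing scale f))"
proof -
  have "istopology (\<lambda>U. \<exists>F \<subseteq> bihoms. U = (\<Union>f\<in>F. nonvanishing scale f))"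
  proof (rule istopology_basic_opens)
    fix f g :: "('a \<Rightarrow> 'b) \<Rightarrow> ('a \<Rightarrow> 'b) \<Rightarrow> 'b"
    assume fg: "f \<in> bihoms" "g \<in> bihoms"
    define h where "h = (\<lambda>\<alpha> \<beta>. f \<alpha> \<beta> * g \<alpha> \<beta>)"
    have h: "h \<in> bihoms"
      using fg unfolding bihoms_def h_def by (blast intro: bihom.mult)
    have "p \<in> nonvanishing scale h \<longleftrightarrow> p \<in> nonvanishing scale f \<inter> nonvanishing scale g" for p
    proof (cases "p \<in> proj_dual scale \<times> proj_dual scale")
      case True
      then obtain \<alpha> \<beta> where ab: "p = (proj_point \<alpha>, proj_point \<beta>)"
          "\<alpha> \<in> nonzero_dual scale" "\<beta> \<in> nonzero_dual scale"
        by (auto simp: proj_dual_def)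
      show ?thesis
        unfolding ab(1) Int_iff nonvanishing_iff[OF h ab(2,3)] nonvanishing_iff[OF fg(1) ab(2,3)]
          nonvanishing_iff[OF fg(2) ab(2,3)]
        by (simp add: h_def)
    qed (use nonvanishing_subset in blast)
    then show "\<exists>h\<in>bihoms. nonvanishing scale h = nonvanishing scale f \<inter> nonvanishing scale g"
      using h by blast
  qed
  then show ?thesis by (simp add: zariski_proj2_def topology_inverse')
qed

lemma topspace_zariski_proj2: "topspace (zariski_proj2 scale) = proj_dual scale \<times> proj_dual scale"
proof
  show "topspace (zariski_proj2 scale) \<subseteq> proj_dual scale \<times> proj_dual scale"
    unfolding topspace_def openin_zariski_proj2 using nonvanishing_subset by blast
  have "openin (zariski_proj2 scale) (nonvanishing scale (\<lambda>_ _. 1))"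
    unfolding openin_zariski_proj2
    by (rule exI[of _ "{\<lambda>_ _. 1}"]) (auto simp: bihoms_def intro: bihom.const)
  moreover have "nonvanishing scale (\<lambda>_ _. 1) = proj_dual scale \<times> proj_dual scale"
    by (auto simp: nonvanishing_def proj_dual_def)
  ultimately show "proj_dual scale \<times> proj_dual scale \<subseteq> topspace (zariski_proj2 scale)"
    by (metis openin_subset)
qed

lemma closedin_zariski_proj2:
  "closedin (zariski_proj2 scale) C \<longleftrightarrow>
    (\<exists>F \<subseteq> bihoms. C = {(proj_point \<alpha>, proj_point \<beta>) | \<alpha> \<beta>.
       \<alpha> \<in> nonzero_dual scale \<and> \<beta> \<in> nonzero_dual scale \<and> (\<forall>f\<in>F. f \<alpha> \<beta> = 0)})"
proof -
  let ?P = "proj_dual scale \<times> proj_dual scale"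
  have Z: "?P - (\<Union>f\<in>F. nonvanishing scale f) = {(proj_point \<alpha>, proj_point \<beta>) | \<alpha> \<beta>.
       \<alpha> \<in> nonzero_dual scale \<and> \<beta> \<in> nonzero_dual scale \<and> (\<forall>f\<in>F. f \<alpha> \<beta> = 0)}" (is "?L = ?R")
    if "F \<subseteq> bihoms" for F
  proof (intro equalityI subsetI)
    fix p assume p: "p \<in> ?L"
    then obtain \<alpha> \<beta> where ab: "p = (proj_point \<alpha>, proj_point \<beta>)"
        "\<alpha> \<in> nonzero_dual scale" "\<beta> \<in> nonzero_dual scale"
      by (auto simp: proj_dual_def)
    have "f \<alpha> \<beta> = 0" if "f \<in> F" for f
      using p that \<open>F \<subseteq> bihoms\<close> nonvanishing_iff[of f, OF _ ab(2,3)] by (auto simp: ab(1))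
    then show "p \<in> ?R" using ab by blast
  next
    fix p assume "p \<in> ?R"
    then obtain \<alpha> \<beta> where p: "p = (proj_point \<alpha>, proj_point \<beta>)" "\<alpha> \<in> nonzero_dual scale"
        "\<beta> \<in> nonzero_dual scale" "\<forall>f\<in>F. f \<alpha> \<beta> = 0" by blast
    have "p \<notin> nonvanishing scale f" if "f \<in> F" for f
      using that \<open>F \<subseteq> bihoms\<close> nonvanishing_iff[of f, OF _ p(2,3)] p(1,4) by auto
    then show "p \<in> ?L" using p(1-3) by (auto simp: proj_dual_def)
  qed
  have *: "C \<subseteq> ?P \<and> ?P - C = (\<Union>f\<in>F. nonvanishing scale f) \<longleftrightarrow>
      C = ?P - (\<Union>f\<in>F. nonvanishing scale f)" for F
    using UN_least[of F "nonvanishing scale" ?P] nonvanishing_subset by blast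
  have "closedin (zariski_proj2 scale) C \<longleftrightarrow>
      (\<exists>F \<subseteq> bihoms. C \<subseteq> ?P \<and> ?P - C = (\<Union>f\<in>F. nonvanishing scale f))"
    unfolding closedin_def openin_zariski_proj2 topspace_zariski_proj2 by blast
  also have "\<dots> \<longleftrightarrow> (\<exists>F \<subseteq> bihoms. C = ?P - (\<Union>f\<in>F. nonvanishing scale f))"
    unfolding * ..
  also have "\<dots> \<longleftrightarrow> (\<exists>F \<subseteq> bihoms. C = {(proj_point \<alpha>, proj_point \<beta>) | \<alpha> \<beta>.
       \<alpha> \<in> nonzero_dual scale \<and> \<beta> \<in> nonzero_dual scale \<and> (\<forall>f\<in>F. f \<alpha> \<beta> = 0)})"
    by (rule ex_cong1) (use Z in auto)
  finally show ?thesis .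
qed

section \<open>Characteristic varieties\<close>

text \<open>
  The defining conditions only depend on the zero sets of \<open>\<alpha>\<close> and \<open>\<beta>\<close>, hence not on the
  choice of representatives of the two points.
\<close>

definition Ch :: "('k::field \<Rightarrow> 'v::ab_group_add \<Rightarrow> 'v) \<Rightarrow> 'v set \<Rightarrow>
    (('v \<Rightarrow> 'k) set \<times> ('v \<Rightarrow> 'k) set) set" where
  "Ch scale X = {(proj_point \<alpha>, proj_point \<beta>) | \<alpha> \<beta>.
     \<alpha> \<in> nonzero_dual scale \<and> \<beta> \<in> nonzero_dual scale \<and>
     (\<forall>x\<in>X. \<alpha> x = 0 \<longrightarrow> \<beta> x = 0)}"

definition Chw :: "('k::field \<Rightarrow> 'v::ab_group_add \<Rightarrow> 'v) \<Rightarrow> 'v set \<Rightarrow>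
    (('v \<Rightarrow> 'k) set \<times> ('v \<Rightarrow> 'k) set) set" where
  "Chw scale X = {(proj_point \<alpha>, proj_point \<beta>) | \<alpha> \<beta>.
     \<alpha> \<in> nonzero_dual scale \<and> \<beta> \<in> nonzero_dual scale \<and>
     (\<forall>x\<in>X. \<alpha> x = 0 \<longleftrightarrow> \<beta> x = 0)}"

end

theory Submission
  imports Defs "Jordan_Normal_Form.Determinant" "HOL-Library.Function_Algebras"
begin

text \<open>
  Let \<open>x\<^sub>0 \<in> X\<close> witness that \<open>(\<alpha>\<^sub>0, \<beta>\<^sub>0)\<close> is not in \<open>Ch(X)\<close>, and write \<open>X = U \<inter> C\<close>
  with \<open>C\<close> closed and \<open>U\<close> containing \<open>{g \<noteq> 0}\<close>, \<open>g x\<^sub>0 \<noteq> 0\<close>. If \<open>(\<alpha>, \<beta>)\<close> lies in \<open>Ch(X)\<close>, then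
  \<open>g * \<beta>\<close> vanishes on \<open>C \<inter> {\<alpha> = 0}\<close>, so \<open>(g * \<beta>)^K = \<alpha> * Q\<close> on \<open>C\<close> by the Nullstellensatz,
  where an effective version bounds \<open>K\<close> and the degree of \<open>Q\<close> independently of \<open>(\<alpha>, \<beta>)\<close>.
  Multiplication by \<open>\<alpha>\<^sub>0\<close> is injective on functions on \<open>X\<close>, as \<open>X\<close> is irreducible and not contained in
  \<open>{\<alpha>\<^sub>0 = 0}\<close>. Hence linear dependence of \<open>(g * \<beta>)^K\<close> on \<open>\<alpha> * P\<close>, \<open>P\<close> the polynomials of bounded degree, is
  expressed by a bihomogeneous determinant that vanishes on \<open>Ch(X)\<close> but not at \<open>(\<alpha>\<^sub>0, \<beta>\<^sub>0)\<close>.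
  For \<open>Chw(X)\<close> the same determinant is used with the two arguments possibly exchanged.
\<close>

section \<open>Polynomial functions of bounded degree\<close>

text \<open>Polynomials of total degree at most d in the first n coordinates, taken as functions.
  Points are infinite sequences, so that the number of variables can change without a change of
  type.\<close>

inductive poly_le :: "nat \<Rightarrow> nat \<Rightarrow> ((nat \<Rightarrow> 'k::field) \<Rightarrow> 'k) \<Rightarrow> bool" for n where
  const: "poly_le n d (\<lambda>_. c)"
| var: "i < n \<Longrightarrow> poly_le n d f \<Longrightarrow> poly_le n (Suc d) (\<lambda>x. x i * f x)"
| add: "poly_le n d f \<Longrightarrow> poly_le n d g \<Longrightarrow> poly_le n d (\<lambda>x. f x + g x)"

lemma poly_le_mono: "poly_le n d f \<Longrightarrow> d \<le> d' \<Longrightarrow> n \<le> n' \<Longrightarrow> poly_le n' d' f"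
proof (induction arbitrary: d' rule: poly_le.induct)
  case (var i d f)
  then show ?case by (cases d') (auto intro: poly_le.var)
qed (auto intro: poly_le.intros)

lemma poly_le_sum: "(\<And>i. i \<in> A \<Longrightarrow> poly_le n d (f i)) \<Longrightarrow> poly_le n d (\<lambda>x. \<Sum>i\<in>A. f i x)"
  by (induction A rule: infinite_finite_induct) (auto intro: poly_le.intros)

lemma poly_le_cmult: "poly_le n d f \<Longrightarrow> poly_le n d (\<lambda>x. c * f x)"
proof (induction rule: poly_le.induct)
  case (var i d f)
  then show ?case using poly_le.var[OF var(1) var(3)] by (simp add: mult.left_commute)
qed (auto simp: distrib_left intro: poly_le.intros)

lemma poly_le_mult:
  "poly_le n a f \<Longrightarrow> poly_le n b g \<Longrightarrow> poly_le n (a + b) (\<lambda>x. f x * g x)"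
proof (induction rule: poly_le.induct)
  case (const d c)
  then show ?case by (intro poly_le_cmult) (auto elim: poly_le_mono)
next
  case (var i d f)
  then show ?case using poly_le.var[of i n "d + b" "\<lambda>x. f x * g x"] by (simp add: mult.assoc)
qed (auto simp: distrib_right intro: poly_le.intros)

lemma poly_le_diff:
  "poly_le n d f \<Longrightarrow> poly_le n d g \<Longrightarrow> poly_le n d (\<lambda>x. f x - g x)"
  using poly_le.add[of n d f "\<lambda>x. -1 * g x"] poly_le_cmult[of n d g "-1"] by simp

lemma poly_le_var: "i < n \<Longrightarrow> poly_le n (Suc 0) (\<lambda>x. x i)"
  using poly_le.var[OF _ poly_le.const[of n 0 1]] by simp

lemma poly_le_power: "poly_le n d f \<Longrightarrow> poly_le n (k * d) (\<lambda>x. f x ^ k)"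
  by (induction k) (auto intro: poly_le.const poly_le_mult)

lemma poly_le_var_power: "i < n \<Longrightarrow> poly_le n k (\<lambda>x. x i ^ k)"
  using poly_le_power[OF poly_le_var, of i n k] by simp

lemma poly_le_prod:
  "(\<And>i. i \<in> A \<Longrightarrow> poly_le n d (f i)) \<Longrightarrow> poly_le n (card A * d) (\<lambda>x. \<Prod>i\<in>A. f i x)"
  by (induction A rule: infinite_finite_induct) (auto intro: poly_le.const poly_le_mult)

lemma poly_le_cong: "poly_le n d f \<Longrightarrow> (\<And>i. i < n \<Longrightarrow> x i = y i) \<Longrightarrow> f x = f y"
  by (induction rule: poly_le.induct) auto

lemma poly_le_0_const: "poly_le n 0 f \<Longrightarrow> \<exists>c. f = (\<lambda>_. c)"
  by (induction "0::nat" f rule: poly_le.induct) auto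

lemma poly_le_no_vars_const: "poly_le 0 d f \<Longrightarrow> \<exists>c. f = (\<lambda>_. c)"
  by (induction rule: poly_le.induct) auto

lemma poly_le_subst:
  assumes "poly_le n d f" "\<And>i. i < n \<Longrightarrow> poly_le m (Suc 0) (\<lambda>x. s x i)"
  shows "poly_le m d (\<lambda>x. f (s x))"
  using assms(1)
proof (induction rule: poly_le.induct)
  case (var i d f)
  then show ?case using poly_le_mult[OF assms(2)[of i] var(3)] by simp
qed (auto intro: poly_le.intros)

text \<open>The degree left for the coefficient of \<open>x n ^ i\<close> is d - i; in particular
  the coefficient of \<open>x n ^ d\<close> is constant.\<close>

lemma poly_le_split_last:
  assumes "poly_le (Suc n) d f"
  shows "\<exists>c. (\<forall>i\<le>d. poly_le n (d - i) (c i)) \<and> f = (\<lambda>x. \<Sum>i\<le>d. c i x * x n ^ i)"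
  using assms
proof (induction rule: poly_le.induct)
  case (const d a)
  let ?c = "\<lambda>i x. if i = 0 then a else 0"
  have "(\<Sum>i\<le>d. ?c i x * x n ^ i) = a" for x :: "nat \<Rightarrow> 'a"
    by (simp add: if_distrib[of "\<lambda>u. u * _"] cong: if_cong)
  then show ?case by (intro exI[of _ ?c]) (auto intro: poly_le.const)
next
  case (var j d f)
  then obtain c where c: "\<forall>i\<le>d. poly_le n (d - i) (c i)" "f = (\<lambda>x. \<Sum>i\<le>d. c i x * x n ^ i)"
    by blast
  show ?case
  proof (cases "j = n")
    case True
    let ?c = "\<lambda>i. if i = 0 then (\<lambda>_. 0) else c (i - 1)"
    have "x j * f x = (\<Sum>i\<le>Suc d. ?c i x * x n ^ i)" for x
      unfolding c(2) True sum.atMost_Suc_shift by (simp add: sum_distrib_left algebra_simps)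
    moreover have "poly_le n (Suc d - i) (?c i)" if "i \<le> Suc d" for i
      using c(1) that by (cases i) (auto intro: poly_le.const)
    ultimately show ?thesis by (intro exI[of _ ?c]) auto
  next
    case False
    with var(1) have j: "j < n" by simp
    let ?c = "\<lambda>i. if i = Suc d then (\<lambda>_. 0) else (\<lambda>x. x j * c i x)"
    have "x j * f x = (\<Sum>i\<le>Suc d. ?c i x * x n ^ i)" for x
      unfolding c(2) by (simp add: sum_distrib_left algebra_simps)
    moreover have "poly_le n (Suc d - i) (?c i)" if "i \<le> Suc d" for i
    proof (cases "i = Suc d")
      case False
      then show ?thesis using poly_le.var[OF j, of "d - i" "c i"] c(1) that
        by (simp add: Suc_diff_le)
    qed (auto intro: poly_le.const)
    ultimately show ?thesis by (intro exI[of _ ?c]) auto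
  qed
next
  case (add d f g)
  then obtain c c' where c: "\<forall>i\<le>d. poly_le n (d - i) (c i)" "f = (\<lambda>x. \<Sum>i\<le>d. c i x * x n ^ i)"
    "\<forall>i\<le>d. poly_le n (d - i) (c' i)" "g = (\<lambda>x. \<Sum>i\<le>d. c' i x * x n ^ i)"
    by blast
  then show ?case
    by (intro exI[of _ "\<lambda>i x. c i x + c' i x"])
      (auto simp: distrib_right sum.distrib intro: poly_le.add)
qed

lemma poly_le_split_lastE:
  assumes "poly_le (Suc n) d f"
  obtains c where "\<And>i. i \<le> d \<Longrightarrow> poly_le n (d - i) (c i)"
    "\<And>x. f x = (\<Sum>i\<le>d. c i x * x n ^ i)"
  using poly_le_split_last[OF assms] by auto

text \<open>Multiplying by a variable moves every homogeneous part up by one degree and leaves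
  nothing in degree 0.\<close>

lemma poly_le_homogeneous_parts:
  assumes "poly_le n d f"
  shows "\<exists>h. (\<forall>j\<le>d. poly_le n j (h j)) \<and> (\<forall>j\<le>d. \<forall>t x. h j (\<lambda>i. t * x i) = t ^ j * h j x) \<and>
    f = (\<lambda>x. \<Sum>j\<le>d. h j x)"
  using assms
proof (induction rule: poly_le.induct)
  case (const d a)
  let ?h = "\<lambda>i x. if i = 0 then a else 0"
  show ?case by (intro exI[of _ ?h]) (auto intro: poly_le.const)
next
  case (var k d f)
  then obtain h where h: "\<forall>j\<le>d. poly_le n j (h j)"
    "\<forall>j\<le>d. \<forall>t x. h j (\<lambda>i. t * x i) = t ^ j * h j x" "f = (\<lambda>x. \<Sum>j\<le>d. h j x)" by blast
  let ?h = "\<lambda>j. if j = 0 then (\<lambda>_. 0) else (\<lambda>x. x k * h (j - 1) x)"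
  have "x k * f x = (\<Sum>j\<le>Suc d. ?h j x)" for x
    unfolding h(3) sum.atMost_Suc_shift by (simp add: sum_distrib_left)
  moreover have "poly_le n j (?h j)" if "j \<le> Suc d" for j
    using h(1) that poly_le.var[OF var(1), of "j - 1" "h (j - 1)"]
    by (cases j) (auto intro: poly_le.const)
  moreover have "?h j (\<lambda>i. t * x i) = t ^ j * ?h j x" if "j \<le> Suc d" for j t x
    using h(2) that by (cases j) auto
  ultimately show ?case by (intro exI[of _ ?h]) auto
next
  case (add d f g)
  then obtain h h' where h: "\<forall>j\<le>d. poly_le n j (h j)"
    "\<forall>j\<le>d. \<forall>t x. h j (\<lambda>i. t * x i) = t ^ j * h j x" "f = (\<lambda>x. \<Sum>j\<le>d. h j x)"
    "\<forall>j\<le>d. poly_le n j (h' j)"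
    "\<forall>j\<le>d. \<forall>t x. h' j (\<lambda>i. t * x i) = t ^ j * h' j x" "g = (\<lambda>x. \<Sum>j\<le>d. h' j x)" by blast
  then show ?case
    by (intro exI[of _ "\<lambda>j x. h j x + h' j x"])
      (auto simp: distrib_left sum.distrib intro: poly_le.add)
qed

lemma poly_le_det:
  assumes "\<And>i j. i < k \<Longrightarrow> j < k \<Longrightarrow> poly_le n d (A i j)"
  shows "poly_le n (k * d) (\<lambda>x. det (mat k k (\<lambda>(i, j). A i j x)))"
proof -
  have eq: "det (mat k k (\<lambda>(i, j). A i j x)) =
      (\<Sum>p\<in>{p. p permutes {0..<k}}. of_int (sign p) * (\<Prod>i=0..<k. A i (p i) x))" for x
    by (auto simp: det_def intro!: sum.cong prod.cong dest!: permutes_in_image)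
  show ?thesis unfolding eq
  proof (intro poly_le_sum poly_le_cmult)
    fix p assume "p \<in> {p. p permutes {0..<k}}"
    then have "p i < k" if "i < k" for i using permutes_in_image[of p "{0..<k}" i] that by auto
    then show "poly_le n (k * d) (\<lambda>x. \<Prod>i=0..<k. A i (p i) x)"
      using poly_le_prod[of "{0..<k}" n d "\<lambda>i. A i (p i)"] assms by simp
  qed
qed

text \<open>An entry of the adjugate is, up to sign, a minor of order k - 1.\<close>

lemma poly_le_adj_mat:
  assumes "\<And>i j. i < k \<Longrightarrow> j < k \<Longrightarrow> poly_le n d (A i j)" "i < k" "j < k"
  shows "poly_le n (k * d) (\<lambda>x. adj_mat (mat k k (\<lambda>(i, j). A i j x)) $$ (i, j))"
proof -
  obtain l where l: "k = Suc l" using assms(2) by (cases k) auto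
  \<comment> \<open>\<open>s a\<close> enumerates the indices other than a in increasing order; it
    describes what \<open>mat_delete\<close> keeps.\<close>
  define s where "s = (\<lambda>a b. if b < a then b else Suc b :: nat)"
  have s: "b < l \<Longrightarrow> s a b < k" for a b by (auto simp: s_def l)
  have eq: "adj_mat (mat k k (\<lambda>(i, j). A i j x)) $$ (i, j) =
      (-1) ^ (j + i) * det (mat l l (\<lambda>(i', j'). A (s j i') (s i j') x))" for x
  proof -
    have "mat_delete (mat k k (\<lambda>(i, j). A i j x)) j i = mat l l (\<lambda>(i', j'). A (s j i') (s i j') x)"
      by (rule eq_matI) (auto simp: mat_delete_def l s_def)
    then show ?thesis using assms(2,3) by (simp add: adj_mat_def cofactor_def)
  qed
  have "poly_le n (l * d) (\<lambda>x. det (mat l l (\<lambda>(i', j'). A (s j i') (s i j') x)))"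
    by (rule poly_le_det) (auto intro: assms(1) s)
  then show ?thesis unfolding eq by (intro poly_le_cmult) (auto elim!: poly_le_mono simp: l)
qed

text \<open>Membership in the ideal generated by F with multipliers of degree at most N. Neither F
  nor the number of summands is bounded; only the degrees have to be uniform.\<close>

inductive trunc_ideal :: "nat \<Rightarrow> nat \<Rightarrow> ((nat \<Rightarrow> 'k::field) \<Rightarrow> 'k) set \<Rightarrow> ((nat \<Rightarrow> 'k) \<Rightarrow> 'k) \<Rightarrow> bool"
  for n N F where
  zero: "trunc_ideal n N F (\<lambda>_. 0)"
| step: "trunc_ideal n N F h \<Longrightarrow> f \<in> F \<Longrightarrow> poly_le n N m \<Longrightarrow> trunc_ideal n N F (\<lambda>x. m x * f x + h x)"

lemma trunc_ideal_mono:
  "trunc_ideal n N F h \<Longrightarrow> n \<le> n' \<Longrightarrow> N \<le> N' \<Longrightarrow> trunc_ideal n' N' F h"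
  by (induction rule: trunc_ideal.induct) (auto intro: trunc_ideal.intros poly_le_mono)

lemma trunc_ideal_gen: "f \<in> F \<Longrightarrow> poly_le n N m \<Longrightarrow> trunc_ideal n N F (\<lambda>x. m x * f x)"
  using trunc_ideal.step[OF trunc_ideal.zero] by fastforce

lemma trunc_ideal_add:
  "trunc_ideal n N F g \<Longrightarrow> trunc_ideal n N F h \<Longrightarrow> trunc_ideal n N F (\<lambda>x. g x + h x)"
  by (induction rule: trunc_ideal.induct) (auto simp: add.assoc intro: trunc_ideal.step)

lemma trunc_ideal_mult:
  "trunc_ideal n N F h \<Longrightarrow> poly_le n M m \<Longrightarrow> trunc_ideal n (M + N) F (\<lambda>x. m x * h x)"
proof (induction rule: trunc_ideal.induct)
  case (step h f p)
  then show ?case using trunc_ideal.step[OF step.IH step(2) poly_le_mult[OF step.prems step(3)]]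
    by (simp add: algebra_simps)
qed (auto intro: trunc_ideal.zero)

lemma trunc_ideal_sum:
  "(\<And>i. i \<in> A \<Longrightarrow> trunc_ideal n N F (h i)) \<Longrightarrow> trunc_ideal n N F (\<lambda>x. \<Sum>i\<in>A. h i x)"
  by (induction A rule: infinite_finite_induct) (auto intro: trunc_ideal.zero trunc_ideal_add)

lemma trunc_ideal_trans:
  assumes "trunc_ideal n M G h" "\<And>g. g \<in> G \<Longrightarrow> trunc_ideal n N F g"
  shows "trunc_ideal n (M + N) F h"
  using assms(1)
proof induction
  case (step h f m)
  then show ?case by (intro trunc_ideal_add trunc_ideal_mult assms(2))
qed (rule trunc_ideal.zero)

text \<open>Substituting \<open>s'\<close> turns each f (s x) back into f x, and an affine
  substitution does not raise the degrees of the multipliers.\<close>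

lemma trunc_ideal_subst:
  assumes "trunc_ideal n N ((\<lambda>f x. f (s x)) ` F) h" "\<And>x. s (s' x) = x"
    "\<And>i. i < n \<Longrightarrow> poly_le n (Suc 0) (\<lambda>x. s' x i)"
  shows "trunc_ideal n N F (\<lambda>x. h (s' x))"
  using assms(1)
proof induction
  case (step h f m)
  then obtain f0 where f: "f0 \<in> F" "f = (\<lambda>x. f0 (s x))" by auto
  show ?case using trunc_ideal.step[OF step(4) f(1) poly_le_subst[OF step(3) assms(3)]]
    by (simp add: f(2) assms(2))
qed (auto intro: trunc_ideal.zero)

section \<open>Polynomials over infinite fields\<close>

lemma polyfun_coeffs_unique:
  fixes c :: "nat \<Rightarrow> 'k::field"
  assumes "infinite (UNIV :: 'k set)" "\<And>t. (\<Sum>i\<le>d. c i * t ^ i) = (\<Sum>i\<le>d. c' i * t ^ i)" "i \<le> d"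
  shows "c i = c' i"
proof -
  define p where "p = (\<Sum>i\<le>d. monom (c i - c' i) i)"
  have "poly p t = 0" for t
    using assms(2)[of t] by (simp add: p_def poly_sum poly_monom left_diff_distrib sum_subtractf)
  then have "p = 0" using poly_roots_finite[of p] assms(1) by auto
  moreover have "coeff p i = c i - c' i"
    using assms(3) by (simp add: p_def coeff_sum coeff_monom)
  ultimately show ?thesis by simp
qed

lemma infinite_UNIV_alg_closed: "infinite (UNIV :: 'k::alg_closed_field set)"
proof
  assume fin: "finite (UNIV :: 'k set)"
  \<comment> \<open>This polynomial takes the value 1 everywhere, although its degree is the
    positive number of field elements.\<close>
  define p :: "'k poly" where "p = (\<Prod>a\<in>UNIV. [:-a, 1:]) + 1"
  have nz: "(\<Prod>a\<in>(UNIV::'k set). [:-a, 1:]) \<noteq> 0" using fin by simp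
  have "degree (\<Prod>a\<in>(UNIV::'k set). [:-a, 1:]) = card (UNIV :: 'k set)"
    by (subst degree_prod_eq_sum_degree) auto
  moreover have "card (UNIV :: 'k set) > 0" using fin by (simp add: card_gt_0_iff)
  ultimately have "degree p > 0" by (simp add: p_def degree_add_eq_left)
  then obtain x where "poly p x = 0" using alg_closed_imp_poly_has_root by blast
  moreover have "poly (\<Prod>a\<in>(UNIV::'k set). [:-a, 1:]) x = 0"
    using fin by (simp add: poly_prod)
  ultimately show False by (simp add: p_def)
qed

section \<open>A uniform Nullstellensatz\<close>

text \<open>A row of a Sylvester matrix is a list of coefficients shifted by k; paired with the
  powers of t, the shift becomes the factor \<open>t ^ k\<close>.\<close>

lemma shifted_row_sum:
  fixes c :: "nat \<Rightarrow> 'k::field"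
  assumes "k + d < s"
  shows "(\<Sum>l<s. (if k \<le> l \<and> l - k \<le> d then c (l - k) else 0) * t ^ l) =
    t ^ k * (\<Sum>l\<le>d. c l * t ^ l)"
proof -
  have "(\<Sum>l<s. (if k \<le> l \<and> l - k \<le> d then c (l - k) else 0) * t ^ l) =
      (\<Sum>l\<in>{k..k+d}. c (l - k) * t ^ l)"
    using assms by (intro sum.mono_neutral_cong_right) auto
  also have "\<dots> = (\<Sum>l\<le>d. c l * t ^ (l + k))"
    by (rule sum.reindex_bij_witness[of _ "\<lambda>l. l + k" "\<lambda>l. l - k"]) auto
  finally show ?thesis by (simp add: sum_distrib_left power_add ac_simps)
qed

text \<open>
  \<open>R\<close> is the determinant of the Sylvester matrix of \<open>f\<close> and \<open>g\<close> with respect to the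
  variable \<open>x n\<close>; over \<open>a\<close> this matrix is lower triangular.
\<close>

lemma eliminate_last_variable:
  fixes f g :: "(nat \<Rightarrow> 'k::field) \<Rightarrow> 'k"
  assumes f: "\<And>x. f x = (\<Sum>l\<le>m. fc l x * x n ^ l)" "\<And>l. l \<le> m \<Longrightarrow> poly_le n M (fc l)"
    and g: "\<And>x. g x = (\<Sum>l\<le>e. gc l x * x n ^ l)" "\<And>l. l \<le> e \<Longrightarrow> poly_le n M (gc l)"
    and a: "fc 0 a = 1" "\<And>l. 0 < l \<Longrightarrow> l \<le> m \<Longrightarrow> fc l a = 0" "gc e a \<noteq> 0"
    and "m > 0" and fF: "trunc_ideal (Suc n) N F f" and gF: "trunc_ideal (Suc n) N F g"
  shows "\<exists>R. poly_le n ((m + e) * M) R \<and>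
    trunc_ideal (Suc n) ((m + e) * M + (m + e + N)) F R \<and> R a \<noteq> 0"
proof -
  define s where "s = m + e"
  \<comment> \<open>The first e rows hold shifted coefficients of f, the other m rows those of g;
    \<open>row\<close> lists the multiples of f and g by powers of \<open>x n\<close> that they
    stand for.\<close>
  define S where "S = (\<lambda>i l.
     if i < e then if i \<le> l \<and> l - i \<le> m then fc (l - i) else (\<lambda>_. 0)
     else if i - e \<le> l \<and> l - (i - e) \<le> e then gc (l - (i - e)) else (\<lambda>_. 0))"
  define A where "A = (\<lambda>x. mat s s (\<lambda>(i, l). S i l x))"
  define row where "row = (\<lambda>i x. if i < e then x n ^ i * f x else x n ^ (i - e) * g x)"
  have A: "A x \<in> carrier_mat s s" for x by (simp add: A_def)
  have S: "poly_le n M (S i l)" for i l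
    by (auto simp: S_def f(2) g(2) poly_le.const split: if_splits)
  have row: "(\<Sum>l<s. S i l x * x n ^ l) = row i x" if "i < s" for i x
  proof (cases "i < e")
    case True
    then show ?thesis
      using shifted_row_sum[of i m s "\<lambda>l. fc l x" "x n"] \<open>m > 0\<close>
      by (simp add: S_def row_def f(1) s_def if_distrib[of "\<lambda>u. u _"] cong: if_cong)
  next
    case False
    then show ?thesis
      using shifted_row_sum[of "i - e" e s "\<lambda>l. gc l x" "x n"] that
      by (simp add: S_def row_def g(1) s_def if_distrib[of "\<lambda>u. u _"] cong: if_cong)
  qed
  have s0: "0 < s" using \<open>m > 0\<close> by (simp add: s_def)
  \<comment> \<open>The first row of the adjugate times the matrix is the determinant times the
    first unit vector. There is a column 0 because m > 0.\<close>
  have adj: "(\<Sum>i<s. adj_mat (A x) $$ (0, i) * S i l x) = (if l = 0 then det (A x) else 0)"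
    if "l < s" for l x
  proof -
    have "(adj_mat (A x) * A x) $$ (0, l) = (\<Sum>i<s. adj_mat (A x) $$ (0, i) * S i l x)"
      using adj_mat(1)[OF A[of x]] A[of x] s0 that
      by (auto simp: scalar_prod_def A_def atLeast0LessThan intro!: sum.cong)
    then show ?thesis
      using adj_mat(3)[OF A[of x]] s0 that by (cases "l = 0") simp_all
  qed
  \<comment> \<open>Pairing this identity with the powers of \<open>x n\<close> writes the
    determinant as a combination of multiples of f and g.\<close>
  have R: "det (A x) = (\<Sum>i<s. adj_mat (A x) $$ (0, i) * row i x)" for x
  proof -
    have "det (A x) = (\<Sum>l<s. (if l = 0 then det (A x) else 0) * x n ^ l)"
      using s0 by (simp add: if_distrib[of "\<lambda>u. u * _"] sum.If_cases cong: if_cong)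
    also have "\<dots> = (\<Sum>l<s. \<Sum>i<s. adj_mat (A x) $$ (0, i) * S i l x * x n ^ l)"
      by (simp add: adj[symmetric] sum_distrib_right)
    also have "\<dots> = (\<Sum>i<s. \<Sum>l<s. adj_mat (A x) $$ (0, i) * S i l x * x n ^ l)"
      by (rule sum.swap)
    finally show ?thesis by (simp add: row[symmetric] sum_distrib_left mult.assoc)
  qed
  have "trunc_ideal (Suc n) (s * M + (s + N)) F (\<lambda>x. adj_mat (A x) $$ (0, i) * row i x)"
    if "i < s" for i
  proof (rule trunc_ideal_mult)
    show "poly_le (Suc n) (s * M) (\<lambda>x. adj_mat (A x) $$ (0, i))"
      using poly_le_adj_mat[of s n M S 0 i] S that s0 unfolding A_def
      by (auto elim: poly_le_mono)
    have "poly_le (Suc n) s (\<lambda>x :: nat \<Rightarrow> 'k. x n ^ k)" if "k \<le> s" for k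
      using poly_le_mono[OF poly_le_var_power[of n "Suc n" k] that order.refl] by simp
    then have "poly_le (Suc n) s (\<lambda>x :: nat \<Rightarrow> 'k. x n ^ i)"
        "poly_le (Suc n) s (\<lambda>x :: nat \<Rightarrow> 'k. x n ^ (i - e))"
      using that by auto
    from trunc_ideal_mult[OF fF this(1)] trunc_ideal_mult[OF gF this(2)]
    show "trunc_ideal (Suc n) (s + N) F (row i)" by (cases "i < e") (simp_all add: row_def)
  qed
  then have "trunc_ideal (Suc n) (s * M + (s + N)) F (\<lambda>x. det (A x))"
    unfolding R by (intro trunc_ideal_sum) auto
  moreover have "poly_le n (s * M) (\<lambda>x. det (A x))"
    unfolding A_def using poly_le_det[of s n M S] S by simp
  \<comment> \<open>At a, all coefficients of f but the constant one vanish, so the diagonal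
    consists of e entries 1 and m entries \<open>gc e a\<close>.\<close>
  moreover have "det (A a) \<noteq> 0"
  proof -
    have "det (A a) = prod_list (diag_mat (A a))"
    proof (rule det_lower_triangular[OF _ A])
      fix i j assume "i < j" "j < s"
      then show "A a $$ (i, j) = 0" using a(2) by (auto simp: A_def S_def)
    qed
    moreover have "A a $$ (i, i) \<noteq> 0" if "i < s" for i
      using that a(1,3) by (auto simp: A_def S_def)
    then have "0 \<notin> set (diag_mat (A a))" using A[of a] by (auto simp: diag_mat_def)
    ultimately show ?thesis by (simp add: prod_list_zero_iff)
  qed
  ultimately show ?thesis unfolding s_def by blast
qed

lemma poly_le_restrict_line:
  assumes "poly_le (Suc n) d f"
  shows "\<exists>p. degree p \<le> d \<and> (\<forall>t. poly p t = f (a(n := t)))"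
proof -
  obtain c where c: "\<And>i. i \<le> d \<Longrightarrow> poly_le n (d - i) (c i)"
      "\<And>x. f x = (\<Sum>i\<le>d. c i x * x n ^ i)"
    by (rule poly_le_split_lastE[OF assms]) (rule that)
  have "c i (a(n := t)) = c i a" if "i \<le> d" for i t
    using c(1)[OF that] by (rule poly_le_cong) auto
  then have "poly (\<Sum>i\<le>d. monom (c i a) i) t = f (a(n := t))" for t
    by (simp add: poly_sum poly_monom c(2))
  moreover have "degree (\<Sum>i\<le>d. monom (c i a) i) \<le> d"
    by (rule degree_sum_le) (auto intro: order.trans[OF degree_monom_le])
  ultimately show ?thesis by blast
qed

lemma poly_le_poly_last: "degree p \<le> d \<Longrightarrow> poly_le (Suc n) d (\<lambda>x. poly p (x n))"
  unfolding poly_altdef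
  by (intro poly_le_sum poly_le_cmult poly_le_mono[OF poly_le_var_power]) auto

text \<open>On the line through a parallel to the last axis, g has at most d roots. For every root r
  some q in F is nonzero there, and 1 - q / q(r) vanishes at r while being 1 modulo the ideal. The
  product W of these factors is a multiple g * s on the line, so s * g + (1 - W) lies in the ideal
  and equals 1 on the line.\<close>

lemma unit_on_line:
  fixes F :: "((nat \<Rightarrow> 'k::alg_closed_field) \<Rightarrow> 'k) set"
  assumes F: "\<And>f. f \<in> F \<Longrightarrow> poly_le (Suc n) d f"
    and g: "g \<in> F" "\<And>x. g x = (\<Sum>l\<le>e. gc l x * x n ^ l)" "\<And>l. l \<le> e \<Longrightarrow> poly_le n d (gc l)"
      "e \<le> d" "gc e a \<noteq> 0"
    and no_zero: "\<And>t. \<exists>q\<in>F. q (a(n := t)) \<noteq> 0"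
  shows "\<exists>f. poly_le (Suc n) (d * d + d) f \<and> trunc_ideal (Suc n) (d * d) F f \<and>
    (\<forall>t. f (a(n := t)) = 1)"
proof -
  define p where "p = (\<Sum>l\<le>e. monom (gc l a) l)"
  have "gc l (a(n := t)) = gc l a" if "l \<le> e" for l t
    using g(3)[OF that] by (rule poly_le_cong) auto
  then have p: "poly p t = g (a(n := t))" for t
    by (simp add: p_def poly_sum poly_monom g(2))
  have "degree p \<le> e"
    unfolding p_def by (rule degree_sum_le) (auto intro: order.trans[OF degree_monom_le])
  moreover have "coeff p e = gc e a" by (simp add: p_def coeff_sum)
  ultimately have p0: "degree p = e" "p \<noteq> 0"
    using g(5) le_degree[of p e] by auto
  obtain A where A: "size A = e" "p = Polynomial.smult (lead_coeff p) (\<Prod>x\<in>#A. [:-x, 1:])"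
    using alg_closed_imp_factorization[OF p0(2)] p0(1) by auto
  obtain q where q: "\<And>r. q r \<in> F" "\<And>r. q r (a(n := r)) \<noteq> 0"
    using no_zero by metis
  define u where "u = (\<lambda>r x. 1 - inverse (q r (a(n := r))) * q r x)"
  have u: "poly_le (Suc n) d (u r)" for r
    unfolding u_def using F[OF q(1)] by (intro poly_le_diff poly_le_cmult poly_le.const)
  then have "\<exists>v. degree v \<le> d \<and> (\<forall>t. poly v t = u r (a(n := t)))" for r
    by (rule poly_le_restrict_line)
  then obtain v where v: "\<And>r. degree (v r) \<le> d" "\<And>r t. poly (v r) t = u r (a(n := t))"
    by metis
  define W where "W = (\<lambda>x. \<Prod>r\<in>#A. u r x)"
  define w where "w = (\<Prod>r\<in>#A. v r)"
  \<comment> \<open>The products stay congruent to 1 modulo F, since 1 - u * b = (1 - u) * b + (1 -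
    b).\<close>
  have W: "poly_le (Suc n) (size B * d) (\<lambda>x. \<Prod>r\<in>#B. u r x) \<and>
      trunc_ideal (Suc n) (size B * d) F (\<lambda>x. 1 - (\<Prod>r\<in>#B. u r x))" for B
  proof (induction B)
    case empty
    then show ?case by (auto intro: poly_le.const trunc_ideal.zero)
  next
    case (add r B)
    define b where "b = (\<lambda>x. \<Prod>r\<in>#B. u r x)"
    have "trunc_ideal (Suc n) (size B * d) F
        (\<lambda>x. (inverse (q r (a(n := r))) * b x) * q r x + (1 - b x))"
      using add unfolding b_def
      by (intro trunc_ideal.step poly_le_cmult q(1)) auto
    also have "(\<lambda>x. (inverse (q r (a(n := r))) * b x) * q r x + (1 - b x)) =
        (\<lambda>x. 1 - u r x * b x)"
      by (simp add: u_def fun_eq_iff algebra_simps)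
    finally have "trunc_ideal (Suc n) (d + size B * d) F (\<lambda>x. 1 - u r x * b x)"
      by (rule trunc_ideal_mono) auto
    moreover have "poly_le (Suc n) (d + size B * d) (\<lambda>x. u r x * b x)"
      using add u unfolding b_def by (intro poly_le_mult) auto
    ultimately show ?case by (simp add: b_def)
  qed
  have ed: "size A * d \<le> d * d" using A(1) g(4) by simp
  have w: "poly w t = W (a(n := t))" for t
  proof -
    define y where "y = a(n := t)"
    have "poly (\<Prod>r\<in>#B. v r) t = (\<Prod>r\<in>#B. u r y)" for B
      by (induction B) (simp_all add: v(2) y_def[symmetric])
    then show ?thesis by (simp add: w_def W_def y_def)
  qed
  have "degree (\<Prod>r\<in>#B. v r) \<le> size B * d" for B
  proof (induction B)
    case (add r B)
    then show ?case using degree_mult_le[of "v r" "\<Prod>r\<in>#B. v r"] v(1)[of r] by simp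
  qed auto
  then have deg_w: "degree w \<le> d * d" using ed unfolding w_def by (meson order.trans)
  \<comment> \<open>A root of multiplicity k contributes k factors to both products, as A is a
    multiset.\<close>
  have "[:-r, 1:] dvd v r" for r
    using q(2)[of r] by (simp add: poly_eq_0_iff_dvd[symmetric] v(2) u_def)
  then have "(\<Prod>r\<in>#B. [:-r, 1:]) dvd (\<Prod>r\<in>#B. v r)" for B
    by (induction B) (simp_all add: mult_dvd_mono del: mult_pCons_left)
  then have "p dvd w"
    unfolding w_def using p0(2) by (subst A(2)) (simp add: smult_dvd_iff)
  then obtain s where s: "w = p * s" by (auto elim: dvdE)
  have deg_s: "degree s \<le> d * d"
    using deg_w p0(2) by (cases "s = 0") (auto simp: s degree_mult_eq)
  define f where "f = (\<lambda>x. poly s (x n) * g x + (1 - W x))"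
  have "poly_le (Suc n) (d * d + d) f"
    unfolding f_def
  proof (rule poly_le.add)
    show "poly_le (Suc n) (d * d + d) (\<lambda>x. poly s (x n) * g x)"
      by (intro poly_le_mult poly_le_poly_last deg_s F g(1))
    have "poly_le (Suc n) (d * d + d) W"
      unfolding W_def using W[of A, THEN conjunct1] by (rule poly_le_mono) (use ed in linarith)+
    then show "poly_le (Suc n) (d * d + d) (\<lambda>x. 1 - W x)"
      by (intro poly_le_diff poly_le.const)
  qed
  moreover have "trunc_ideal (Suc n) (d * d) F f"
    unfolding f_def using W[of A] ed unfolding W_def
    by (intro trunc_ideal.step g(1) poly_le_poly_last deg_s) (auto elim: trunc_ideal_mono)
  moreover have "f (a(n := t)) = 1" for t
    using w[of t] by (simp add: f_def p[symmetric] s mult.commute)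
  ultimately show ?thesis by blast
qed

text \<open>On each line parallel to the last axis, h has every nonzero parameter as a root. Hence a
  vector on which a nonzero form does not vanish can be chosen with nonzero last coordinate, which
  makes the shear below invertible.\<close>

lemma poly_le_zero_off_hyperplane:
  fixes h :: "(nat \<Rightarrow> 'k::field) \<Rightarrow> 'k"
  assumes "infinite (UNIV :: 'k set)" "poly_le (Suc n) d h" "\<And>v. v n \<noteq> 0 \<Longrightarrow> h v = 0"
  shows "h v = 0"
proof -
  obtain p where p: "\<And>t. poly p t = h (v(n := t))"
    using poly_le_restrict_line[OF assms(2)] by blast
  have "poly p t = 0" if "t \<noteq> 0" for t
    using assms(3)[of "v(n := t)"] that by (simp add: p)
  then have "UNIV - {0} \<subseteq> {t. poly p t = 0}" by auto
  then have "p = 0"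
    using poly_roots_finite[of p] assms(1) finite_subset[of "UNIV - {0}" "{t. poly p t = 0}"]
    by auto
  then show ?thesis using p[of "v n"] by simp
qed

text \<open>The coefficient of \<open>t ^ e\<close> in g (t * v) is the value at v of the part of
  degree e. If this is nonzero and the last axis is mapped to the line through v, then the
  coefficient of \<open>x n ^ e\<close> becomes a nonzero constant.\<close>

lemma shear_to_monic:
  fixes g :: "(nat \<Rightarrow> 'k::field) \<Rightarrow> 'k"
  assumes inf: "infinite (UNIV :: 'k set)" and g: "poly_le (Suc n) d g" "g y \<noteq> 0"
  obtains s s' e gc where "e \<le> d" "\<And>i. i < Suc n \<Longrightarrow> poly_le (Suc n) (Suc 0) (\<lambda>x. s x i)"
    "\<And>i. i < Suc n \<Longrightarrow> poly_le (Suc n) (Suc 0) (\<lambda>x. s' x i)" "\<And>x. s (s' x) = x"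
    "\<And>x. g (s x) = (\<Sum>l\<le>e. gc l x * x n ^ l)" "\<And>l. l \<le> e \<Longrightarrow> poly_le n d (gc l)"
    "\<And>a. gc e a \<noteq> 0"
proof -
  \<comment> \<open>The least degree bound, so that the part of degree e does not vanish
    identically.\<close>
  define e where "e = (LEAST e. poly_le (Suc n) e g)"
  have e: "poly_le (Suc n) e g" "e \<le> d"
    using g(1) unfolding e_def by (auto intro: LeastI Least_le)
  obtain h where h: "\<And>j. j \<le> e \<Longrightarrow> poly_le (Suc n) j (h j)"
    "\<And>j t x. j \<le> e \<Longrightarrow> h j (\<lambda>i. t * x i) = t ^ j * h j x" "\<And>x. g x = (\<Sum>j\<le>e. h j x)"
    using poly_le_homogeneous_parts[OF e(1)] by blast
  have "\<exists>v. h e v \<noteq> 0"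
  proof (rule ccontr)
    assume "\<nexists>v. h e v \<noteq> 0"
    then have z: "h e v = 0" for v by blast
    have "poly_le (Suc n) (e - 1) g \<and> e \<noteq> 0"
    proof (cases e)
      case 0
      then show ?thesis using z h(3)[of y] g(2) by simp
    next
      case (Suc k)
      then have "g = (\<lambda>x. \<Sum>j\<le>k. h j x)" using h(3) z by auto
      moreover have "poly_le (Suc n) k (h j)" if "j \<le> k" for j
        using h(1)[of j] by (rule poly_le_mono) (use that Suc in auto)
      ultimately show ?thesis using Suc by (auto intro!: poly_le_sum)
    qed
    then show False
      using Least_le[of "\<lambda>e. poly_le (Suc n) e g" "e - 1", folded e_def] by linarith
  qed
  then obtain v where v: "h e v \<noteq> 0" "v n \<noteq> 0"
    using poly_le_zero_off_hyperplane[OF inf h(1)[OF order.refl]] by blast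
  \<comment> \<open>\<open>s\<close> maps the last axis to the line through v, and \<open>s'\<close>
    undoes it.\<close>
  define s where "s = (\<lambda>x i. if i < n then x i + v i * x n else if i = n then v n * x n else x i)"
  define s' where
    "s' = (\<lambda>x i. if i < n then x i - v i * (x n / v n) else if i = n then x n / v n else x i)"
  have s: "poly_le (Suc n) (Suc 0) (\<lambda>x. s x i)" if "i < Suc n" for i
  proof (cases "i = n")
    case False
    then show ?thesis using that unfolding s_def
      by (auto intro!: poly_le.add poly_le_cmult poly_le_var)
  qed (auto simp: s_def intro!: poly_le_cmult poly_le_var)
  have div: "x n / v n = inverse (v n) * x n" for x :: "nat \<Rightarrow> 'k" by (simp add: field_simps)
  have s': "poly_le (Suc n) (Suc 0) (\<lambda>x. s' x i)" if "i < Suc n" for i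
  proof (cases "i = n")
    case False
    then show ?thesis using that unfolding s'_def div
      by (auto intro!: poly_le_diff poly_le_cmult poly_le_var)
  qed (auto simp: s'_def div intro!: poly_le_cmult poly_le_var)
  have ss': "s (s' x) = x" for x using v(2) by (auto simp: s_def s'_def fun_eq_iff)
  have gs: "poly_le (Suc n) e (\<lambda>x. g (s x))"
    by (rule poly_le_subst[where s = s, OF e(1) s])
  obtain c where c: "\<And>i. i \<le> e \<Longrightarrow> poly_le n (e - i) (c i)"
      "\<And>x. g (s x) = (\<Sum>i\<le>e. c i x * x n ^ i)"
    by (rule poly_le_split_lastE[OF gs]) (rule that)
  have "c e a \<noteq> 0" for a
  proof -
    \<comment> \<open>The coefficient of \<open>x n ^ e\<close> has degree at most e - e = 0, so its
      value can be computed on the last axis.\<close>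
    define z where "z = (\<lambda>t i. if i = n then t else 0 :: 'k)"
    have c0: "c i (z t) = c i (z 0)" if "i \<le> e" for i t
      using c(1)[OF that] by (rule poly_le_cong) (auto simp: z_def)
    have "(\<Sum>i\<le>e. c i (z 0) * t ^ i) = (\<Sum>i\<le>e. h i v * t ^ i)" for t
    proof -
      have "(\<Sum>i\<le>e. c i (z 0) * t ^ i) = g (s (z t))"
        using c(2)[of "z t"] c0 by (simp add: z_def)
      also have "\<dots> = g (\<lambda>i. t * v i)"
        by (rule poly_le_cong[OF e(1)]) (auto simp: s_def z_def less_Suc_eq)
      also have "\<dots> = (\<Sum>i\<le>e. h i v * t ^ i)" by (simp add: h(2,3) mult.commute)
      finally show ?thesis .
    qed
    then have "c e (z 0) = h e v"
      by (rule polyfun_coeffs_unique[OF inf]) simp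
    moreover have "\<exists>b. c e = (\<lambda>_. b)"
      using c(1)[of e] by (intro poly_le_0_const[of n]) simp
    ultimately show ?thesis using v(1) by metis
  qed
  moreover have "poly_le n d (c l)" if "l \<le> e" for l
    using c(1)[OF that] by (rule poly_le_mono) (use e(2) in auto)
  ultimately show ?thesis using that[OF e(2) s s' ss' c(2)] by blast
qed

text \<open>
  An effective version of Arrondo's elementary proof of the Nullstellensatz. \<open>G\<close> plays the role
  of the elimination ideal; a common zero of \<open>G\<close> would lift to one of \<open>F\<close>.
\<close>

lemma uniform_nullstellensatz:
  "\<exists>N. \<forall>F :: ((nat \<Rightarrow> 'k::alg_closed_field) \<Rightarrow> 'k) set.
     (\<forall>f\<in>F. poly_le n d f) \<and> (\<forall>x. \<exists>f\<in>F. f x \<noteq> 0) \<longrightarrow> trunc_ideal n N F (\<lambda>_. 1)"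
proof (induction n arbitrary: d)
  case 0
  have "trunc_ideal 0 0 F (\<lambda>_. 1)"
    if F: "\<forall>f\<in>F. poly_le 0 d f" "\<forall>x. \<exists>f\<in>F. f x \<noteq> 0" for F :: "((nat \<Rightarrow> 'k) \<Rightarrow> 'k) set"
  proof -
    obtain f where f: "f \<in> F" "f (\<lambda>_. 0) \<noteq> 0" using F(2) by blast
    then obtain c where "f = (\<lambda>_. c)" using F(1) poly_le_no_vars_const by blast
    then show ?thesis
      using trunc_ideal_gen[OF f(1) poly_le.const[of 0 0 "inverse c"]] f(2) by simp
  qed
  then show ?case by blast
next
  case (Suc n)
  \<comment> \<open>m bounds the degree of the polynomial from \<open>unit_on_line\<close>, the
    summand 1 making it positive. D bounds the degree of the Sylvester determinant, and N that of
    its multipliers over F.\<close>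
  define m where "m = d * d + d + 1"
  define D where "D = (m + d) * m"
  define N where "N = D + (m + d + d * d)"
  obtain N' where N': "\<And>G :: ((nat \<Rightarrow> 'k) \<Rightarrow> 'k) set. (\<forall>f\<in>G. poly_le n D f) \<Longrightarrow>
      (\<forall>x. \<exists>f\<in>G. f x \<noteq> 0) \<Longrightarrow> trunc_ideal n N' G (\<lambda>_. 1)"
    using Suc.IH[of D] by blast
  have monic: "trunc_ideal (Suc n) (N' + N) F (\<lambda>_. 1)"
    if F: "\<forall>f\<in>F. poly_le (Suc n) d f" "\<forall>x. \<exists>f\<in>F. f x \<noteq> 0"
      and g: "g \<in> F" "\<And>x. g x = (\<Sum>l\<le>e. gc l x * x n ^ l)" "\<And>l. l \<le> e \<Longrightarrow> poly_le n d (gc l)"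
        "e \<le> d" "\<And>a. gc e a \<noteq> 0"
    for F :: "((nat \<Rightarrow> 'k) \<Rightarrow> 'k) set" and g e gc
  proof -
    \<comment> \<open>Elements of the ideal of F that are free of \<open>x n\<close>.\<close>
    define G where "G = {R. poly_le n D R \<and> trunc_ideal (Suc n) N F R}"
    \<comment> \<open>On the line over a, the ideal contains a polynomial equal to 1; its resultant
      with g is nonzero at a.\<close>
    have "\<exists>R\<in>G. R a \<noteq> 0" for a
    proof -
      have "\<And>f. f \<in> F \<Longrightarrow> poly_le (Suc n) d f" "\<And>t. \<exists>q\<in>F. q (a(n := t)) \<noteq> 0"
        using F by blast+
      then obtain f where f: "poly_le (Suc n) (d * d + d) f" "trunc_ideal (Suc n) (d * d) F f"
          "\<And>t. f (a(n := t)) = 1"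
        using unit_on_line[where F = F and n = n and d = d and g = g and e = e and gc = gc and a = a] g by blast
      have fm: "poly_le (Suc n) m f" using f(1) by (rule poly_le_mono) (auto simp: m_def)
      obtain fc where fc: "\<And>i. i \<le> m \<Longrightarrow> poly_le n (m - i) (fc i)"
          "\<And>x. f x = (\<Sum>i\<le>m. fc i x * x n ^ i)"
        by (rule poly_le_split_lastE[OF fm]) (rule that)
      have "fc i (a(n := t)) = fc i a" if "i \<le> m" for i t
        using fc(1)[OF that] by (rule poly_le_cong) auto
      then have "(\<Sum>i\<le>m. fc i a * t ^ i) = (\<Sum>i\<le>m. (if i = 0 then 1 else 0) * t ^ i)" for t
        using fc(2)[of "a(n := t)"] f(3)[of t]
        by (simp add: if_distrib[of "\<lambda>u. u * _"] cong: if_cong)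
      then have fca: "fc i a = (if i = 0 then 1 else 0)" if "i \<le> m" for i
        using that by (rule polyfun_coeffs_unique[OF infinite_UNIV_alg_closed])
      have "trunc_ideal (Suc n) (d * d) F g"
        using trunc_ideal_gen[OF g(1) poly_le.const[of "Suc n" "d * d" 1]] by simp
      moreover have "poly_le n m (fc l)" if "l \<le> m" for l
        using fc(1)[OF that] by (rule poly_le_mono) auto
      moreover have "poly_le n m (gc l)" if "l \<le> e" for l
        using g(3)[OF that] by (rule poly_le_mono) (auto simp: m_def)
      ultimately obtain R where R: "poly_le n ((m + e) * m) R"
          "trunc_ideal (Suc n) ((m + e) * m + (m + e + d * d)) F R" "R a \<noteq> 0"
        using eliminate_last_variable[where f = f and m = m and fc = fc and n = n and M = m
            and g = g and e = e and gc = gc and a = a and N = "d * d" and F = F] fc(2) g(2,5) fca f(2)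
        by (auto simp: m_def)
      have le: "(m + e) * m \<le> D" using g(4) by (simp add: D_def)
      have "poly_le n D R" using R(1) le by (rule poly_le_mono) auto
      moreover have "trunc_ideal (Suc n) N F R"
        using R(2) by (rule trunc_ideal_mono) (use le g(4) in \<open>auto simp: N_def\<close>)
      ultimately show ?thesis using R(3) by (auto simp: G_def)
    qed
    \<comment> \<open>The induction hypothesis writes 1 over G; expanding the elements of G over F
      adds N to the degree of the multipliers.\<close>
    then have "trunc_ideal (Suc n) N' G (\<lambda>_. 1)"
      using trunc_ideal_mono[OF N'[of G]] by (auto simp: G_def)
    then show ?thesis by (rule trunc_ideal_trans) (auto simp: G_def)
  qed
  have "trunc_ideal (Suc n) (N' + N) F (\<lambda>_. 1)"
    if F: "\<forall>f\<in>F. poly_le (Suc n) d f" "\<forall>x. \<exists>f\<in>F. f x \<noteq> 0" for F :: "((nat \<Rightarrow> 'k) \<Rightarrow> 'k) set"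
  proof -
    obtain g where g: "g \<in> F" "g (\<lambda>_. 0) \<noteq> 0" using F(2) by blast
    have gd: "poly_le (Suc n) d g" using F(1) g(1) by blast
    obtain s s' e gc where s: "e \<le> d" "\<And>i. i < Suc n \<Longrightarrow> poly_le (Suc n) (Suc 0) (\<lambda>x. s x i)"
      "\<And>i. i < Suc n \<Longrightarrow> poly_le (Suc n) (Suc 0) (\<lambda>x. s' x i)" "\<And>x. s (s' x) = x"
      "\<And>x. g (s x) = (\<Sum>l\<le>e. gc l x * x n ^ l)" "\<And>l. l \<le> e \<Longrightarrow> poly_le n d (gc l)"
      "\<And>a. gc e a \<noteq> 0"
      by (rule shear_to_monic[OF infinite_UNIV_alg_closed gd g(2)]) (rule that)
    have "trunc_ideal (Suc n) (N' + N) ((\<lambda>f x. f (s x)) ` F) (\<lambda>_. 1)"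
    proof (rule monic)
      have "poly_le (Suc n) d (\<lambda>x. f (s x))" if "f \<in> F" for f
        by (rule poly_le_subst[where s = s, OF F(1)[rule_format, OF that] s(2)])
      then show "\<forall>f\<in>(\<lambda>f x. f (s x)) ` F. poly_le (Suc n) d f" by blast
      show "\<forall>x. \<exists>f\<in>(\<lambda>f x. f (s x)) ` F. f x \<noteq> 0"
        by (simp add: F(2)[rule_format])
      show "(\<lambda>x. g (s x)) \<in> (\<lambda>f x. f (s x)) ` F" using g(1) by (rule imageI)
    qed (fact s)+
    from trunc_ideal_subst[OF this s(4) s(3)] show ?thesis .
  qed
  then show ?case by blast
qed

section \<open>Hilbert's basis theorem\<close>

text \<open>Rings are sets inside an ambient ring, later the functions on V, so that generators can
  be adjoined without a change of type.\<close>

definition subring_on :: "'a::comm_ring_1 set \<Rightarrow> bool" where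
  "subring_on R \<longleftrightarrow> 0 \<in> R \<and> 1 \<in> R \<and> (\<forall>a\<in>R. \<forall>b\<in>R. a + b \<in> R \<and> a * b \<in> R) \<and> (\<forall>a\<in>R. - a \<in> R)"

definition ideal_on :: "'a::comm_ring_1 set \<Rightarrow> 'a set \<Rightarrow> bool" where
  "ideal_on R I \<longleftrightarrow> I \<subseteq> R \<and> 0 \<in> I \<and> (\<forall>a\<in>I. \<forall>b\<in>I. a + b \<in> I) \<and> (\<forall>r\<in>R. \<forall>a\<in>I. r * a \<in> I)"

inductive_set ideal_gen :: "'a::comm_ring_1 set \<Rightarrow> 'a set \<Rightarrow> 'a set" for R G where
  zero: "0 \<in> ideal_gen R G"
| step: "a \<in> ideal_gen R G \<Longrightarrow> r \<in> R \<Longrightarrow> g \<in> G \<Longrightarrow> r * g + a \<in> ideal_gen R G"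

definition noetherian_on :: "'a::comm_ring_1 set \<Rightarrow> bool" where
  "noetherian_on R \<longleftrightarrow> (\<forall>I. ideal_on R I \<longrightarrow> (\<exists>G. finite G \<and> G \<subseteq> I \<and> I \<subseteq> ideal_gen R G))"

text \<open>R[x] in Horner form; x may satisfy algebraic relations over R.\<close>

inductive_set adjoin :: "'a::comm_ring_1 set \<Rightarrow> 'a \<Rightarrow> 'a set" for R x where
  base: "r \<in> R \<Longrightarrow> r \<in> adjoin R x"
| step: "a \<in> adjoin R x \<Longrightarrow> r \<in> R \<Longrightarrow> r + x * a \<in> adjoin R x"

lemma subring_onD:
  assumes "subring_on R"
  shows "0 \<in> R" "1 \<in> R" "a \<in> R \<Longrightarrow> b \<in> R \<Longrightarrow> a + b \<in> R" "a \<in> R \<Longrightarrow> b \<in> R \<Longrightarrow> a * b \<in> R"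
    "a \<in> R \<Longrightarrow> - a \<in> R"
  using assms unfolding subring_on_def by blast+

lemma ideal_onD:
  assumes "ideal_on R I"
  shows "I \<subseteq> R" "0 \<in> I" "a \<in> I \<Longrightarrow> b \<in> I \<Longrightarrow> a + b \<in> I" "r \<in> R \<Longrightarrow> a \<in> I \<Longrightarrow> r * a \<in> I"
  using assms unfolding ideal_on_def by blast+

lemma subring_on_adjoin:
  assumes R: "subring_on R"
  shows "subring_on (adjoin R x)"
proof -
  note RD = subring_onD[OF R]
  have add: "a + b \<in> adjoin R x" if "a \<in> adjoin R x" "b \<in> adjoin R x" for a b
    using that
  proof (induction arbitrary: b)
    case (base r)
    from base(2) show ?case
    proof cases
      case base
      then show ?thesis using \<open>r \<in> R\<close> RD(3) by (auto intro: adjoin.base)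
    next
      case (step a s)
      then show ?thesis using \<open>r \<in> R\<close> adjoin.step[of a R x "r + s"] RD(3)
        by (simp add: add.assoc)
    qed
  next
    case (step a r)
    from step(4) show ?case
    proof cases
      case base
      then show ?thesis using step adjoin.step[of a R x "r + b"] RD(3) by (simp add: ac_simps)
    next
      case (step a' s)
      then show ?thesis
        using step.IH[OF step(2)] adjoin.step[of "a + a'" R x "r + s"] RD(3) \<open>r \<in> R\<close>
        by (simp add: algebra_simps)
    qed
  qed
  have smult: "r * a \<in> adjoin R x" if "a \<in> adjoin R x" "r \<in> R" for a r
    using that(1)
  proof induction
    case (step a s)
    then show ?case using adjoin.step[of "r * a" R x "r * s"] RD(4) that(2)
      by (simp add: algebra_simps)
  qed (auto intro: adjoin.base RD(4) that(2))
  have xmult: "x * a \<in> adjoin R x" if "a \<in> adjoin R x" for a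
    using adjoin.step[OF that RD(1)] by simp
  have mult: "a * b \<in> adjoin R x" if "a \<in> adjoin R x" "b \<in> adjoin R x" for a b
    using that(1)
  proof induction
    case (step a s)
    then show ?case using add[OF smult[OF that(2) step(2)] xmult[OF step(3)]]
      by (simp add: algebra_simps)
  qed (auto intro: smult that(2))
  have minus: "- a \<in> adjoin R x" if "a \<in> adjoin R x" for a
    using smult[OF that RD(5)[OF RD(2)]] by simp
  show ?thesis unfolding subring_on_def
    using add mult minus RD(1,2) by (auto intro: adjoin.base)
qed

lemma adjoin_gen: "subring_on R \<Longrightarrow> x \<in> adjoin R x"
  using adjoin.step[OF adjoin.base, of 1 R 0 x] by (simp add: subring_onD)

lemma adjoin_mono: "R \<subseteq> adjoin R x"
  by (auto intro: adjoin.base)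

lemma ideal_gen_add: "a \<in> ideal_gen R G \<Longrightarrow> b \<in> ideal_gen R G \<Longrightarrow> a + b \<in> ideal_gen R G"
  by (induction rule: ideal_gen.induct) (auto simp: add.assoc intro: ideal_gen.intros)

lemma ideal_gen_mult:
  assumes "subring_on R" "r \<in> R" "a \<in> ideal_gen R G"
  shows "r * a \<in> ideal_gen R G"
  using assms(3)
proof induction
  case (step a s g)
  then show ?case using ideal_gen.step[OF step.IH subring_onD(4)[OF assms(1,2) step(2)] step(3)]
    by (simp add: algebra_simps)
qed (simp add: ideal_gen.zero)

lemma ideal_gen_subset_ring: "subring_on R \<Longrightarrow> G \<subseteq> R \<Longrightarrow> ideal_gen R G \<subseteq> R"
proof
  fix a assume R: "subring_on R" "G \<subseteq> R" and "a \<in> ideal_gen R G"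
  from this(3) show "a \<in> R" by induction (use R in \<open>auto intro!: subring_onD\<close>)
qed

lemma ideal_on_ideal_gen: "subring_on R \<Longrightarrow> G \<subseteq> R \<Longrightarrow> ideal_on R (ideal_gen R G)"
  unfolding ideal_on_def
  by (intro conjI ballI ideal_gen_subset_ring ideal_gen.zero ideal_gen_add ideal_gen_mult)

lemma ideal_gen_base: "subring_on R \<Longrightarrow> g \<in> G \<Longrightarrow> g \<in> ideal_gen R G"
  using ideal_gen.step[OF ideal_gen.zero, of 1 R g G] by (simp add: subring_onD)

text \<open>Values at x of polynomials of degree below j. Such a value need not determine the
  coefficients, so degree belongs to a representation, not to an element.\<close>

definition pols_below :: "'a::comm_ring_1 set \<Rightarrow> 'a \<Rightarrow> nat \<Rightarrow> 'a set" where
  "pols_below R x j = {(\<Sum>i<j. c i * x ^ i) | c. \<forall>i. c i \<in> R}"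

lemma pols_below_add:
  assumes "subring_on R" "p \<in> pols_below R x j" "q \<in> pols_below R x j"
  shows "p + q \<in> pols_below R x j"
proof -
  obtain c c' where "\<forall>i. c i \<in> R" "\<forall>i. c' i \<in> R" "p = (\<Sum>i<j. c i * x ^ i)" "q = (\<Sum>i<j. c' i * x ^ i)"
    using assms(2,3) by (auto simp: pols_below_def)
  then show ?thesis unfolding pols_below_def
    by (intro CollectI exI[of _ "\<lambda>i. c i + c' i"])
      (auto simp: distrib_right sum.distrib intro: subring_onD(3)[OF assms(1)])
qed

lemma pols_below_smult:
  assumes "subring_on R" "p \<in> pols_below R x j" "r \<in> R"
  shows "r * p \<in> pols_below R x j"
proof -
  obtain c where "\<forall>i. c i \<in> R" "p = (\<Sum>i<j. c i * x ^ i)"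
    using assms(2) by (auto simp: pols_below_def)
  then show ?thesis unfolding pols_below_def
    by (intro CollectI exI[of _ "\<lambda>i. r * c i"])
      (auto simp: sum_distrib_left mult.assoc intro: subring_onD(4)[OF assms(1)] assms(3))
qed

lemma pols_below_zero: "subring_on R \<Longrightarrow> 0 \<in> pols_below R x j"
  unfolding pols_below_def by (intro CollectI exI[of _ "\<lambda>_. 0"]) (auto intro: subring_onD)

lemma pols_below_Suc:
  assumes "subring_on R"
  shows "p \<in> pols_below R x (Suc j) \<longleftrightarrow> (\<exists>q\<in>pols_below R x j. \<exists>c\<in>R. p = q + c * x ^ j)"
proof
  assume "p \<in> pols_below R x (Suc j)"
  then show "\<exists>q\<in>pols_below R x j. \<exists>c\<in>R. p = q + c * x ^ j"
    by (auto simp: pols_below_def)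
next
  assume "\<exists>q\<in>pols_below R x j. \<exists>c\<in>R. p = q + c * x ^ j"
  then obtain c b where c: "\<forall>i. c i \<in> R" "b \<in> R" "p = (\<Sum>i<j. c i * x ^ i) + b * x ^ j"
    by (auto simp: pols_below_def)
  then show "p \<in> pols_below R x (Suc j)" unfolding pols_below_def
    by (intro CollectI exI[of _ "\<lambda>i. if i = j then b else c i"]) auto
qed

lemma pols_below_xmult:
  assumes "subring_on R" "p \<in> pols_below R x j"
  shows "x ^ k * p \<in> pols_below R x (j + k)"
proof (induction k)
  case (Suc k)
  then obtain c where c: "\<forall>i. c i \<in> R" "x ^ k * p = (\<Sum>i<j + k. c i * x ^ i)"
    by (auto simp: pols_below_def)
  have "x ^ Suc k * p = (\<Sum>i<Suc (j + k). (if i = 0 then 0 else c (i - 1)) * x ^ i)"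
    unfolding sum.lessThan_Suc_shift using c(2)
    by (simp add: sum_distrib_left mult.assoc mult.left_commute)
  then show ?case unfolding pols_below_def using c(1) subring_onD(1)[OF assms(1)]
    by (intro CollectI exI[of _ "\<lambda>i. if i = 0 then 0 else c (i - 1)"]) auto
qed (use assms in simp)

lemma pols_below_mono:
  assumes "subring_on R" "p \<in> pols_below R x j" "j \<le> k"
  shows "p \<in> pols_below R x k"
  using assms(3)
proof (induction rule: dec_induct)
  case (step k)
  then show ?case unfolding pols_below_Suc[OF assms(1)]
    using subring_onD(1)[OF assms(1)] by (intro bexI[of _ p] bexI[of _ 0]) auto
qed (fact assms(2))

lemma adjoin_eq_pols_below:
  assumes "subring_on R" "a \<in> adjoin R x"
  shows "\<exists>j. a \<in> pols_below R x j"
  using assms(2)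
proof induction
  case (base r)
  then have "r \<in> pols_below R x (Suc 0)"
    unfolding pols_below_Suc[OF assms(1)] using pols_below_zero[OF assms(1)] by force
  then show ?case by blast
next
  case (step a r)
  then obtain j where "a \<in> pols_below R x j" by blast
  then have "x * a \<in> pols_below R x (Suc j)"
    using pols_below_xmult[OF assms(1), of a x j 1] by simp
  moreover have "r \<in> pols_below R x (Suc 0)"
    unfolding pols_below_Suc[OF assms(1)] using pols_below_zero[OF assms(1)] step(2) by force
  then have "r \<in> pols_below R x (Suc j)" by (rule pols_below_mono[OF assms(1)]) simp
  ultimately show ?case using pols_below_add[OF assms(1)] by blast
qed

text \<open>Hilbert's argument: the leading coefficients c of elements q + c * x ^ j of I form an
  increasing sequence of ideals \<open>L j\<close> of R, stationary from some J on. Lifts of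
  finitely many generators of \<open>L 0\<close>, ..., \<open>L J\<close> generate I, since leading
  terms can be cancelled one degree after the other.\<close>

lemma noetherian_on_adjoin:
  assumes R: "subring_on R" and noeth: "noetherian_on R"
  shows "noetherian_on (adjoin R x)"
  unfolding noetherian_on_def
proof (intro allI impI)
  fix I assume I: "ideal_on (adjoin R x) I"
  note ID = ideal_onD[OF I] and RD = subring_onD[OF R]
  have A: "subring_on (adjoin R x)" by (rule subring_on_adjoin[OF R])
  have xA: "x ^ k \<in> adjoin R x" for k
    by (induction k) (auto intro: subring_onD[OF A] adjoin_gen[OF R])
  have RI: "r * a \<in> I" if "r \<in> R" "a \<in> I" for r a
    using ID(4) that adjoin.base by blast
  define L where "L = (\<lambda>j. {c\<in>R. \<exists>q\<in>pols_below R x j. q + c * x ^ j \<in> I})"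
  have L: "ideal_on R (L j)" for j
    unfolding ideal_on_def
  proof (intro conjI ballI)
    show "0 \<in> L j" unfolding L_def using RD(1) pols_below_zero[OF R] ID(2) by force
    show "L j \<subseteq> R" by (auto simp: L_def)
  next
    fix a b assume "a \<in> L j" "b \<in> L j"
    then obtain p q where pq: "a \<in> R" "b \<in> R" "p \<in> pols_below R x j" "q \<in> pols_below R x j"
      "p + a * x ^ j \<in> I" "q + b * x ^ j \<in> I" by (auto simp: L_def)
    have "(p + q) + (a + b) * x ^ j \<in> I"
      using ID(3)[OF pq(5,6)] by (simp add: algebra_simps)
    then show "a + b \<in> L j"
      unfolding L_def using pols_below_add[OF R pq(3,4)] RD(3)[OF pq(1,2)] by blast
  next
    fix r a assume "r \<in> R" "a \<in> L j"
    then obtain p where p: "a \<in> R" "p \<in> pols_below R x j" "p + a * x ^ j \<in> I"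
      by (auto simp: L_def)
    have "r * p + (r * a) * x ^ j \<in> I"
      using RI[OF \<open>r \<in> R\<close> p(3)] by (simp add: algebra_simps)
    then show "r * a \<in> L j"
      unfolding L_def using pols_below_smult[OF R p(2)] RD(4) \<open>r \<in> R\<close> p(1) by blast
  qed
  have L_mono: "L j \<subseteq> L k" if "j \<le> k" for j k
  proof
    fix a assume "a \<in> L j"
    then obtain p where p: "a \<in> R" "p \<in> pols_below R x j" "p + a * x ^ j \<in> I"
      by (auto simp: L_def)
    have "x ^ (k - j) * (p + a * x ^ j) = x ^ (k - j) * p + a * x ^ k"
      using that by (simp add: algebra_simps flip: power_add)
    moreover have "x ^ (k - j) * p \<in> pols_below R x k"
      using pols_below_xmult[OF R p(2), of "k - j"] that by simp
    moreover have "x ^ (k - j) * (p + a * x ^ j) \<in> I" by (rule ID(4)[OF xA p(3)])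
    ultimately show "a \<in> L k" unfolding L_def using p(1) by auto
  qed
  \<comment> \<open>The sequence becomes stationary because the union is finitely generated and all
    its generators occur in a single \<open>L J\<close>.\<close>
  have LU: "ideal_on R (\<Union>j. L j)"
    unfolding ideal_on_def
  proof (intro conjI ballI)
    fix a b assume "a \<in> (\<Union>j. L j)" "b \<in> (\<Union>j. L j)"
    then obtain j k where "a \<in> L j" "b \<in> L k" by blast
    then have "a \<in> L (max j k)" "b \<in> L (max j k)" using L_mono by (meson max.cobounded1 max.cobounded2 subsetD)+
    then show "a + b \<in> (\<Union>j. L j)" using ideal_onD(3)[OF L] by blast
  next
    show "(\<Union>j. L j) \<subseteq> R" "0 \<in> (\<Union>j. L j)" using ideal_onD(1,2)[OF L] by blast+
  next
    fix r a assume "r \<in> R" "a \<in> (\<Union>j. L j)"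
    then show "r * a \<in> (\<Union>j. L j)" using ideal_onD(4)[OF L] by blast
  qed
  obtain GU where GU: "finite GU" "GU \<subseteq> (\<Union>j. L j)" "(\<Union>j. L j) \<subseteq> ideal_gen R GU"
    using noeth LU unfolding noetherian_on_def by blast
  have "\<exists>J. GU \<subseteq> L J"
    using GU(1,2)
  proof (induction GU)
    case (insert a G)
    then obtain J k where "G \<subseteq> L J" "a \<in> L k" by auto
    then have "insert a G \<subseteq> L (max J k)" using L_mono[of J "max J k"] L_mono[of k "max J k"] by auto
    then show ?case by blast
  qed auto
  then obtain J where J: "GU \<subseteq> L J" by blast
  have "\<exists>G. finite G \<and> G \<subseteq> L j \<and> L j \<subseteq> ideal_gen R G" for j
    using noeth L unfolding noetherian_on_def by blast
  then obtain G where G: "\<And>j. finite (G j)" "\<And>j. G j \<subseteq> L j" "\<And>j. L j \<subseteq> ideal_gen R (G j)"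
    by metis
  \<comment> \<open>Beyond J the generators of \<open>L J\<close> serve for every j, hence the index
    \<open>min j J\<close>.\<close>
  have LJ: "L j \<subseteq> ideal_gen R (G (min j J))" for j
  proof (cases "j \<le> J")
    case True
    then show ?thesis using G(3) by (simp add: min_def)
  next
    case False
    have "a \<in> L J" if "a \<in> ideal_gen R GU" for a
      using that by induction (use J ideal_onD[OF L] in auto)
    then have "L j \<subseteq> L J" using GU(3) by blast
    then show ?thesis using False G(3)[of J] by (simp add: min_def)
  qed
  define lift where "lift = (\<lambda>j c. SOME q. q \<in> pols_below R x j \<and> q + c * x ^ j \<in> I)"
  have lift: "lift j c \<in> pols_below R x j \<and> lift j c + c * x ^ j \<in> I" if "c \<in> L j" for j c
    unfolding lift_def by (rule someI_ex) (use that in \<open>auto simp: L_def\<close>)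
  define H where "H = (\<Union>j\<le>J. (\<lambda>c. lift j c + c * x ^ j) ` G j)"
  have HI: "H \<subseteq> I" using lift G(2) by (auto simp: H_def)
  have HG: "ideal_gen (adjoin R x) H \<subseteq> I"
  proof
    fix a assume "a \<in> ideal_gen (adjoin R x) H"
    then show "a \<in> I" by induction (use HI ID in auto)
  qed
  \<comment> \<open>The leading term a * x ^ j is matched inside the ideal of H; lifts of degree k =
    \<open>min j J\<close> are raised by x ^ (j - k).\<close>
  have approx: "\<exists>h\<in>ideal_gen (adjoin R x) H. \<exists>q\<in>pols_below R x j. h = q + a * x ^ j"
    if "a \<in> ideal_gen R (G (min j J))" for a j
    using that
  proof induction
    case zero
    then show ?case using pols_below_zero[OF R] ideal_gen.zero by force
  next
    case (step a r g)
    define k where "k = min j J"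
    obtain h q where hq: "h \<in> ideal_gen (adjoin R x) H" "q \<in> pols_below R x j" "h = q + a * x ^ j"
      using step.IH by blast
    have "lift k g + g * x ^ k \<in> H" using step(3) by (auto simp: H_def k_def)
    then have "(r * x ^ (j - k)) * (lift k g + g * x ^ k) + h \<in> ideal_gen (adjoin R x) H"
      using hq(1) step(2) by (intro ideal_gen.step subring_onD(4)[OF A] xA adjoin.base)
    moreover have "(r * x ^ (j - k)) * (lift k g + g * x ^ k) + h =
        (r * (x ^ (j - k) * lift k g) + q) + (r * g + a) * x ^ j"
    proof -
      have "x ^ j = x ^ (j - k) * x ^ k" by (simp add: k_def flip: power_add)
      then show ?thesis by (simp add: hq(3) algebra_simps)
    qed
    moreover have "lift k g \<in> pols_below R x k" using lift G(2) step(3) by (auto simp: k_def)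
    then have "x ^ (j - k) * lift k g \<in> pols_below R x j"
      using pols_below_xmult[OF R, of "lift k g" x k "j - k"] by (simp add: k_def)
    ultimately show ?case
      using pols_below_add[OF R pols_below_smult[OF R _ step(2)] hq(2)] by blast
  qed
  \<comment> \<open>Subtracting the matching element leaves an element of I with a representation of
    smaller degree.\<close>
  have below: "a \<in> ideal_gen (adjoin R x) H" if "a \<in> I" "a \<in> pols_below R x j" for a j
    using that
  proof (induction j arbitrary: a)
    case 0
    then have "a = 0" by (auto simp: pols_below_def)
    then show ?case by (simp add: ideal_gen.zero)
  next
    case (Suc j)
    then obtain p c where p: "p \<in> pols_below R x j" "c \<in> R" "a = p + c * x ^ j"
      unfolding pols_below_Suc[OF R] by blast
    then have "c \<in> L j" using Suc(2) by (auto simp: L_def)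
    then obtain h q where hq: "h \<in> ideal_gen (adjoin R x) H" "q \<in> pols_below R x j"
        "h = q + c * x ^ j"
      using approx LJ by blast
    have m1: "-1 \<in> R" "-1 \<in> adjoin R x" using RD(2,5) adjoin.base by blast+
    have "a + -1 * h \<in> I"
      using Suc(2) hq(1) HG by (intro ID(3) ID(4) m1) auto
    moreover have "a + -1 * h = p + -1 * q" by (simp add: p(3) hq(3))
    then have "a + -1 * h \<in> pols_below R x j"
      using pols_below_add[OF R p(1) pols_below_smult[OF R hq(2) m1(1)]] by simp
    ultimately have "a + -1 * h \<in> ideal_gen (adjoin R x) H" by (rule Suc.IH)
    from ideal_gen_add[OF this hq(1)] show ?case by simp
  qed
  have "I \<subseteq> ideal_gen (adjoin R x) H"
    using below adjoin_eq_pols_below[OF R] ID(1) by blast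
  moreover have "finite H" using G(1) by (auto simp: H_def)
  ultimately show "\<exists>G. finite G \<and> G \<subseteq> I \<and> I \<subseteq> ideal_gen (adjoin R x) G" using HI by blast
qed

text \<open>The constants form a field, so any nonzero element generates every ideal that contains
  it.\<close>

lemma noetherian_on_constants:
  "subring_on (range (\<lambda>c (_ :: 'v). c :: 'k::field)) \<and> noetherian_on (range (\<lambda>c (_ :: 'v). c :: 'k))"
proof
  let ?R = "range (\<lambda>c (_ :: 'v). c :: 'k)"
  show R: "subring_on ?R"
    unfolding subring_on_def by (auto simp: fun_eq_iff zero_fun_def one_fun_def plus_fun_def times_fun_def fun_Compl_def image_iff)
  show "noetherian_on ?R"
    unfolding noetherian_on_def
  proof (intro allI impI)
    fix I assume I: "ideal_on ?R I"
    show "\<exists>G. finite G \<and> G \<subseteq> I \<and> I \<subseteq> ideal_gen ?R G"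
    proof (cases "I \<subseteq> {0}")
      case True
      then show ?thesis by (intro exI[of _ "{}"]) (auto intro: ideal_gen.zero)
    next
      case False
      then obtain f where f: "f \<in> I" "f \<noteq> 0" by blast
      then obtain c where c: "f = (\<lambda>_. c)" "c \<noteq> 0"
        using ideal_onD(1)[OF I] by (auto simp: zero_fun_def)
      have "h \<in> ideal_gen ?R {f}" if "h \<in> I" for h
      proof -
        have "h \<in> ?R" using that ideal_onD(1)[OF I] by blast
        then obtain b where b: "h = (\<lambda>_. b)" by (rule rangeE)
        have "(\<lambda>_. b / c) * f + 0 \<in> ideal_gen ?R {f}"
          by (intro ideal_gen.step ideal_gen.zero) auto
        also have "(\<lambda>_. b / c) * f + 0 = h"
          using c by (auto simp: b fun_eq_iff)
        finally show ?thesis .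
      qed
      then show ?thesis using f(1) by blast
    qed
  qed
qed

lemma adjoin_least: "subring_on S \<Longrightarrow> R \<subseteq> S \<Longrightarrow> x \<in> S \<Longrightarrow> adjoin R x \<subseteq> S"
proof
  fix a assume S: "subring_on S" "R \<subseteq> S" "x \<in> S" and "a \<in> adjoin R x"
  from this(4) show "a \<in> S" by induction (use S in \<open>auto intro!: subring_onD(3,4)\<close>)
qed

lemma adjoin_list_least:
  "subring_on S \<Longrightarrow> R \<subseteq> S \<Longrightarrow> set xs \<subseteq> S \<Longrightarrow> fold (\<lambda>x R. adjoin R x) xs R \<subseteq> S"
  by (induction xs arbitrary: R) (simp_all add: adjoin_least)

lemma noetherian_on_adjoin_list:
  assumes "subring_on R" "noetherian_on R"
  shows "subring_on (fold (\<lambda>x R. adjoin R x) xs R) \<and> noetherian_on (fold (\<lambda>x R. adjoin R x) xs R) \<and>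
    R \<subseteq> fold (\<lambda>x R. adjoin R x) xs R \<and> set xs \<subseteq> fold (\<lambda>x R. adjoin R x) xs R"
  using assms
proof (induction xs arbitrary: R)
  case (Cons x xs)
  have "subring_on (adjoin R x)" "noetherian_on (adjoin R x)"
    using Cons.prems subring_on_adjoin noetherian_on_adjoin by blast+
  then show ?case using Cons.IH[of "adjoin R x"] adjoin_gen[OF Cons.prems(1), of x] adjoin_mono[of R x]
    by auto
qed auto

section \<open>Coordinates on the vector space\<close>

text \<open>\<open>expansion\<close> makes \<open>point\<close> a left inverse of
  \<open>coords\<close>: functions on V become functions of sequences through \<open>point\<close>
  and return through \<open>coords\<close>.\<close>

locale coordinates = vector_space scale
  for scale :: "'k::alg_closed_field \<Rightarrow> 'v::ab_group_add \<Rightarrow> 'v" +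
  fixes r :: nat and b :: "nat \<Rightarrow> 'v" and \<phi> :: "nat \<Rightarrow> 'v \<Rightarrow> 'k"
  assumes dual_\<phi>: "i < r \<Longrightarrow> \<phi> i \<in> dual scale"
    and expansion: "(\<Sum>i<r. scale (\<phi> i x) (b i)) = x"
begin

definition coords :: "'v \<Rightarrow> nat \<Rightarrow> 'k" where
  "coords x = (\<lambda>i. \<phi> i x)"

text \<open>Only the first r entries count, which leaves entry r free for an additional
  variable.\<close>

definition point :: "(nat \<Rightarrow> 'k) \<Rightarrow> 'v" where
  "point y = (\<Sum>i<r. scale (y i) (b i))"

lemma point_coords: "point (coords x) = x"
  by (simp add: point_def coords_def expansion)

lemma point_cong: "(\<And>i. i < r \<Longrightarrow> y i = z i) \<Longrightarrow> point y = point z"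
  by (simp add: point_def)

lemma dual_point: "\<alpha> \<in> dual scale \<Longrightarrow> \<alpha> (point y) = (\<Sum>i<r. y i * \<alpha> (b i))"
  unfolding dual_def point_def
  by (simp add: module_hom.sum module_hom.scale linear_iff_module_hom)

lemma poly_le_dual: "\<alpha> \<in> dual scale \<Longrightarrow> poly_le r (Suc 0) (\<lambda>y. \<alpha> (point y))"
  unfolding dual_point mult.commute[of _ "\<alpha> _"]
  by (intro poly_le_sum poly_le_cmult poly_le_var) auto

lemma polyfuns_imp_poly_le: "f \<in> polyfuns scale \<Longrightarrow> \<exists>d. poly_le r d (\<lambda>y. f (point y))"
proof (induction rule: polyfuns.induct)
  case (add f g)
  then obtain d e where "poly_le r d (\<lambda>y. f (point y))" "poly_le r e (\<lambda>y. g (point y))" by blast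
  then have "poly_le r (max d e) (\<lambda>y. f (point y) + g (point y))"
    by (intro poly_le.add) (auto elim: poly_le_mono)
  then show ?case by blast
next
  case (mult f g)
  then obtain d e where "poly_le r d (\<lambda>y. f (point y))" "poly_le r e (\<lambda>y. g (point y))" by blast
  from poly_le_mult[OF this] show ?case by blast
qed (blast intro: poly_le.const poly_le_dual)+

lemma poly_le_imp_polyfuns: "poly_le r d q \<Longrightarrow> (\<lambda>x. q (coords x)) \<in> polyfuns scale"
proof (induction rule: poly_le.induct)
  case (var i d f)
  then show ?case using polyfuns.mult[OF polyfuns.functional[OF dual_\<phi>[OF var(1)]] var(3)]
    by (simp add: coords_def)
qed (auto intro: polyfuns.intros)

lemma subring_on_polyfuns: "subring_on (polyfuns scale)"
  unfolding subring_on_def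
  using polyfuns.const[of 0 scale] polyfuns.const[of 1 scale] polyfuns.add[of _ scale] polyfuns.mult[of _ scale]
    polyfuns.mult[OF polyfuns.const[of "-1" scale]]
  by (simp add: zero_fun_def one_fun_def plus_fun_def times_fun_def fun_Compl_def)

text \<open>k[V] arises from the field of constants by adjoining the coordinate functionals one by
  one, as every functional is a linear combination of these.\<close>

lemma noetherian_on_polyfuns: "noetherian_on (polyfuns scale)"
proof -
  define C where "C = range (\<lambda>c (_ :: 'v). c :: 'k)"
  define R where "R = fold (\<lambda>x R. adjoin R x) (map \<phi> [0..<r]) C"
  have C: "subring_on C" "noetherian_on C" "C \<subseteq> polyfuns scale"
    using noetherian_on_constants polyfuns.const unfolding C_def by blast+
  have R: "subring_on R" "noetherian_on R" "C \<subseteq> R" "\<And>i. i < r \<Longrightarrow> \<phi> i \<in> R"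
    using noetherian_on_adjoin_list[OF C(1,2), of "map \<phi> [0..<r]"] unfolding R_def by auto
  have "R \<subseteq> polyfuns scale"
    unfolding R_def using C(3) polyfuns.functional[OF dual_\<phi>]
    by (intro adjoin_list_least[OF subring_on_polyfuns]) auto
  moreover have "f \<in> R" if "f \<in> polyfuns scale" for f
    using that
  proof (induction rule: polyfuns.induct)
    case (const c)
    then show ?case using R(3) by (auto simp: C_def)
  next
    case (functional \<alpha>)
    have "(\<Sum>i\<in>A. (\<lambda>_. \<alpha> (b i)) * \<phi> i) \<in> R" if "A \<subseteq> {..<r}" for A
      using finite_subset[OF that finite_lessThan] that
    proof (induction A)
      case (insert i A)
      have "(\<lambda>_. \<alpha> (b i)) \<in> R" using R(3) by (auto simp: C_def)
      then have "(\<lambda>_. \<alpha> (b i)) * \<phi> i \<in> R" using insert R(4) by (intro subring_onD(4)[OF R(1)]) auto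
      moreover have "(\<Sum>i\<in>A. (\<lambda>_. \<alpha> (b i)) * \<phi> i) \<in> R" using insert by blast
      ultimately show ?case
        unfolding sum.insert[OF insert(1,2)] by (rule subring_onD(3)[OF R(1)])
    qed (use subring_onD[OF R(1)] in simp)
    moreover have "\<alpha> = (\<Sum>i<r. (\<lambda>_. \<alpha> (b i)) * \<phi> i)"
    proof
      fix x
      have "(\<Sum>i\<in>A. (\<lambda>_. \<alpha> (b i)) * \<phi> i) x = (\<Sum>i\<in>A. coords x i * \<alpha> (b i))" for A
        by (induction A rule: infinite_finite_induct) (auto simp: coords_def mult.commute)
      then show "\<alpha> x = (\<Sum>i<r. (\<lambda>_. \<alpha> (b i)) * \<phi> i) x"
        using dual_point[OF functional, of "coords x"] by (simp add: point_coords)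
    qed
    ultimately show ?case by (metis order.refl)
  next
    case (add f g)
    then show ?case using subring_onD(3)[OF R(1)] by (simp add: plus_fun_def)
  next
    case (mult f g)
    then show ?case using subring_onD(4)[OF R(1)] by (simp add: times_fun_def)
  qed
  ultimately have "polyfuns scale = R" by blast
  then show ?thesis using R(2) by simp
qed

text \<open>Finitely many equations have a common degree bound, as the uniform Nullstellensatz
  demands. Generators of the ideal spanned by all equations have the same common zeros.\<close>

lemma closedin_zariski_finite:
  assumes "closedin (zariski scale) C"
  obtains G where "finite G" "G \<subseteq> polyfuns scale" "C = {x. \<forall>f\<in>G. f x = 0}"
proof -
  obtain F where F: "F \<subseteq> polyfuns scale" "C = {x. \<forall>f\<in>F. f x = 0}"
    using assms unfolding closedin_zariski by blast
  define I where "I = ideal_gen (polyfuns scale) F"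
  have van: "f x = 0" if "f \<in> ideal_gen (polyfuns scale) G" "\<forall>g\<in>G. g x = 0" for f x G
    using that(1) by induction (use that(2) in auto)
  have "ideal_on (polyfuns scale) I"
    unfolding I_def using ideal_on_ideal_gen[OF subring_on_polyfuns F(1)] .
  then obtain G where G: "finite G" "G \<subseteq> I" "I \<subseteq> ideal_gen (polyfuns scale) G"
    using noetherian_on_polyfuns unfolding noetherian_on_def by blast
  have "C = {x. \<forall>f\<in>G. f x = 0}"
  proof (intro equalityI subsetI CollectI ballI)
    fix x f assume "x \<in> C" "f \<in> G"
    then show "f x = 0" using van[of f F x] G(2) F(2) unfolding I_def by blast
  next
    fix x assume x: "x \<in> {x. \<forall>f\<in>G. f x = 0}"
    have "f x = 0" if "f \<in> F" for f
      using van[of f G x] x G(3) ideal_gen_base[OF subring_on_polyfuns that] unfolding I_def by blast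
    then show "x \<in> C" using F(2) by blast
  qed
  moreover have "G \<subseteq> polyfuns scale"
    using G(2) ideal_gen_subset_ring[OF subring_on_polyfuns F(1)] unfolding I_def by blast
  ultimately show ?thesis using that G(1) by blast
qed

text \<open>Rabinowitsch trick; \<open>x r\<close> is the additional variable.\<close>

lemma uniform_divisibility:
  assumes C: "closedin (zariski scale) C" and g: "g \<in> polyfuns scale"
  shows "\<exists>K M. 0 < K \<and> (\<forall>\<alpha>\<in>dual scale. \<forall>\<beta>\<in>dual scale.
    (\<forall>x\<in>C. \<alpha> x = 0 \<longrightarrow> g x * \<beta> x = 0) \<longrightarrow>
    (\<exists>Q. poly_le r M Q \<and> (\<forall>x\<in>C. (g x * \<beta> x) ^ K = \<alpha> x * Q (coords x))))"
proof -
  obtain G where G: "finite G" "G \<subseteq> polyfuns scale" "C = {x. \<forall>f\<in>G. f x = 0}"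
    by (rule closedin_zariski_finite[OF C]) (rule that)
  have "\<exists>d. \<forall>f\<in>G. poly_le r d (\<lambda>y. f (point y))"
    using G(1,2)
  proof (induction G)
    case (insert f G)
    then obtain d e where de: "\<And>f. f \<in> G \<Longrightarrow> poly_le r d (\<lambda>y. f (point y))"
        "poly_le r e (\<lambda>y. f (point y))"
      using polyfuns_imp_poly_le[of f] by auto
    have "poly_le r (max d e) (\<lambda>y. h (point y))" if "h \<in> insert f G" for h
      using poly_le_mono[OF de(1), of h "max d e" r] poly_le_mono[OF de(2), of "max d e" r] that
      by auto
    then show ?case by blast
  qed auto
  then obtain d where d: "\<And>f. f \<in> G \<Longrightarrow> poly_le r d (\<lambda>y. f (point y))" by blast
  obtain e where e: "poly_le r e (\<lambda>y. g (point y))" using polyfuns_imp_poly_le[OF g] by blast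
  \<comment> \<open>1 - y r * u y has degree at most e + 2, since u is g times a functional; the
    bound depends on neither \<alpha> nor \<beta>.\<close>
  define D where "D = max d (e + 2)"
  obtain N where N: "\<And>F :: ((nat \<Rightarrow> 'k) \<Rightarrow> 'k) set. \<forall>f\<in>F. poly_le (Suc r) D f \<Longrightarrow>
      \<forall>x. \<exists>f\<in>F. f x \<noteq> 0 \<Longrightarrow> trunc_ideal (Suc r) N F (\<lambda>_. 1)"
    using uniform_nullstellensatz[of "Suc r" D] by blast
  define M where "M = N + Suc N * (e + 1)"
  show ?thesis
  proof (rule exI[of _ "Suc N"], rule exI[of _ M], intro conjI ballI impI)
    fix \<alpha> \<beta> assume ab: "\<alpha> \<in> dual scale" "\<beta> \<in> dual scale"
      and van: "\<forall>x\<in>C. \<alpha> x = 0 \<longrightarrow> g x * \<beta> x = 0"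
    define u where "u = (\<lambda>y. g (point y) * \<beta> (point y))"
    define A where "A = (\<lambda>f y. f (point y)) ` G"
    \<comment> \<open>A common zero y would give a point of C with \<alpha> = 0 and with
      \<open>y r\<close> inverse to g * \<beta>.\<close>
    define F where "F = insert (\<lambda>y. \<alpha> (point y)) (insert (\<lambda>y. 1 - y r * u y) A)"
    have u: "poly_le r (e + 1) u"
      unfolding u_def using poly_le_mult[OF e poly_le_dual[OF ab(2)]] by simp
    have "poly_le (Suc r) D f" if "f \<in> F" for f
    proof -
      have "poly_le (Suc r) (e + 1) u" using u by (rule poly_le_mono) auto
      then have "poly_le (Suc r) (Suc (e + 1)) (\<lambda>y. 1 - y r * u y)"
        by (intro poly_le_diff poly_le.const poly_le.var) auto
      then have "poly_le (Suc r) D (\<lambda>y. 1 - y r * u y)"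
        by (rule poly_le_mono) (auto simp: D_def)
      moreover have "poly_le (Suc r) D (\<lambda>y. \<alpha> (point y))"
        using poly_le_dual[OF ab(1)] by (rule poly_le_mono) (auto simp: D_def)
      moreover have "poly_le (Suc r) D f" if "f \<in> A"
      proof -
        from that obtain h where "h \<in> G" "f = (\<lambda>y. h (point y))" unfolding A_def by blast
        then show ?thesis using poly_le_mono[OF d, of h D "Suc r"] by (simp add: D_def)
      qed
      ultimately show ?thesis using that unfolding F_def by blast
    qed
    moreover have "\<exists>f\<in>F. f y \<noteq> 0" for y
    proof (rule ccontr)
      assume "\<not> (\<exists>f\<in>F. f y \<noteq> 0)"
      then have "\<forall>f\<in>G. f (point y) = 0" "\<alpha> (point y) = 0" "1 - y r * u y = 0"
        by (auto simp: F_def A_def)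
      then show False using van G(3) by (auto simp: u_def)
    qed
    ultimately have "trunc_ideal (Suc r) N F (\<lambda>_. 1)" using N by blast
    \<comment> \<open>Where the equations of C and y r * u y = 1 hold, only the multiples of
      \<alpha> survive.\<close>
    moreover have "\<exists>q. poly_le (Suc r) N q \<and> (\<forall>y. (\<forall>f\<in>A. f y = 0) \<longrightarrow> 1 - y r * u y = 0 \<longrightarrow>
        h y = q y * \<alpha> (point y))" if "trunc_ideal (Suc r) N F h" for h
      using that
    proof induction
      case zero
      then show ?case by (intro exI[of _ "\<lambda>_. 0"]) (auto intro: poly_le.const)
    next
      case (step h f m)
      then obtain q where q: "poly_le (Suc r) N q"
        "\<forall>y. (\<forall>f\<in>A. f y = 0) \<longrightarrow> 1 - y r * u y = 0 \<longrightarrow> h y = q y * \<alpha> (point y)" by blast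
      show ?case
      proof (cases "f = (\<lambda>y. \<alpha> (point y))")
        case True
        then show ?thesis using q step(3)
          by (intro exI[of _ "\<lambda>y. m y + q y"]) (auto simp: distrib_right intro: poly_le.add)
      next
        case False
        then show ?thesis using q step(2) by (intro exI[of _ q]) (auto simp: F_def)
      qed
    qed
    ultimately obtain q where q: "poly_le (Suc r) N q"
      "\<And>y. (\<forall>f\<in>A. f y = 0) \<Longrightarrow> 1 - y r * u y = 0 \<Longrightarrow> 1 = q y * \<alpha> (point y)" by blast
    obtain c where c: "\<And>i. i \<le> N \<Longrightarrow> poly_le r (N - i) (c i)"
      "\<And>y. q y = (\<Sum>i\<le>N. c i y * y r ^ i)"
      by (rule poly_le_split_lastE[OF q(1)]) (rule that)
    \<comment> \<open>Substituting 1 / u for \<open>y r\<close> and multiplying by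
      \<open>u ^ Suc N\<close> clears the denominators. With Suc N instead of N all exponents are
      positive, so Q also vanishes where u does.\<close>
    define Q where "Q = (\<lambda>y. \<Sum>i\<le>N. c i y * u y ^ (Suc N - i))"
    have "poly_le r M (\<lambda>y. c i y * u y ^ (Suc N - i))" if "i \<le> N" for i
    proof (rule poly_le_mono[OF poly_le_mult[OF c(1)[OF that] poly_le_power[OF u]]])
      show "N - i + (Suc N - i) * (e + 1) \<le> M"
        unfolding M_def by (intro add_mono mult_right_mono) auto
    qed simp
    then have "poly_le r M Q" unfolding Q_def by (intro poly_le_sum) auto
    moreover have "(g x * \<beta> x) ^ Suc N = \<alpha> x * Q (coords x)" if "x \<in> C" for x
    proof -
      have ux: "u (coords x) = g x * \<beta> x" by (simp add: u_def point_coords)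
      show ?thesis
      proof (cases "g x * \<beta> x = 0")
        case True
        have "Q (coords x) = 0"
          unfolding Q_def ux True by (intro sum.neutral ballI) (simp add: power_0_left)
        then show ?thesis unfolding True by simp
      next
        case False
        define t where "t = g x * \<beta> x"
        have t: "t \<noteq> 0" using False by (simp add: t_def)
        define y where "y = (coords x)(r := inverse t)"
        have yr: "y r = inverse t" by (simp add: y_def)
        have cong: "y i = coords x i" if "i < r" for i using that by (simp add: y_def)
        have "point y = point (coords x)" by (rule point_cong) (rule cong)
        then have px: "point y = x" by (simp add: point_coords)
        have uy: "u y = t" by (simp add: u_def px t_def)
        have "1 = q y * \<alpha> (point y)"
        proof (rule q(2))
          show "\<forall>f\<in>A. f y = 0" using that G(3) by (auto simp: A_def px)
          show "1 - y r * u y = 0" using t by (simp add: uy yr)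
        qed
        moreover have "c i y = c i (coords x)" if "i \<le> N" for i
          by (rule poly_le_cong[OF c(1)[OF that] cong])
        ultimately have "1 = (\<Sum>i\<le>N. c i (coords x) * inverse t ^ i) * \<alpha> x"
          by (simp add: c(2) px yr)
        then have "t ^ Suc N = (\<Sum>i\<le>N. c i (coords x) * inverse t ^ i) * \<alpha> x * t ^ Suc N"
          by simp
        also have "\<dots> = \<alpha> x * (\<Sum>i\<le>N. c i (coords x) * (inverse t ^ i * t ^ Suc N))"
          by (simp add: sum_distrib_left sum_distrib_right ac_simps)
        also have "\<dots> = \<alpha> x * Q (coords x)"
        proof -
          have "inverse t ^ i * t ^ Suc N = t ^ (Suc N - i)" if "i \<le> N" for i
          proof -
            have "t ^ Suc N = t ^ i * t ^ (Suc N - i)" using that by (simp flip: power_add)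
            moreover have "inverse t ^ i * t ^ i = 1" using t by (simp flip: power_mult_distrib)
            ultimately show ?thesis by (metis mult.assoc mult_1_left)
          qed
          then show ?thesis by (simp add: Q_def ux t_def[symmetric] del: power_Suc)
        qed
        finally show ?thesis unfolding t_def .
      qed
    qed
    ultimately show "\<exists>Q. poly_le r M Q \<and> (\<forall>x\<in>C. (g x * \<beta> x) ^ Suc N = \<alpha> x * Q (coords x))"
      by blast
  qed simp
qed

end

section \<open>Existence of coordinates; kernels of functionals\<close>

lemma exists_coordinates:
  fixes scale :: "'k::alg_closed_field \<Rightarrow> 'v::ab_group_add \<Rightarrow> 'v"
  assumes "finite_dimensional_vector_space scale Basis"
  shows "\<exists>r b \<phi>. coordinates scale r b \<phi>"
proof -
  interpret finite_dimensional_vector_space scale Basis by fact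
  obtain h where h: "bij_betw h {0..<card Basis} Basis"
    using ex_bij_betw_nat_finite[OF finite_Basis] by blast
  have "coordinates scale (card Basis) h (\<lambda>i x. representation Basis x (h i))"
  proof
    show "(\<lambda>x. representation Basis x (h i)) \<in> dual scale" for i
      unfolding dual_def using linear_representation[OF independent_Basis span_Basis] by simp
    show "(\<Sum>i<card Basis. scale (representation Basis x (h i)) (h i)) = x" for x
      using sum.reindex_bij_betw[OF h, of "\<lambda>b. scale (representation Basis x b) b"]
        sum_representation_eq[OF independent_Basis _ finite_Basis order.refl, of x] span_Basis
      by (simp add: atLeast0LessThan)
  qed
  then show ?thesis by blast
qed

text \<open>A vector v with \<alpha> v nonzero spans V together with the kernel: subtract \<alpha> x
  / \<alpha> v times v from x.\<close>

lemma homogeneous_hyperplane_kernel: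
  fixes scale :: "'k::field \<Rightarrow> 'v::ab_group_add \<Rightarrow> 'v"
  assumes "finite_dimensional_vector_space scale Basis" "\<alpha> \<in> nonzero_dual scale"
  shows "homogeneous_hyperplane scale {x. \<alpha> x = 0}"
proof -
  interpret finite_dimensional_vector_space scale Basis by fact
  have lin: "Vector_Spaces.linear scale (*) \<alpha>" and "\<alpha> \<noteq> (\<lambda>_. 0)"
    using assms(2) by (auto simp: nonzero_dual_def dual_def)
  then obtain v where v: "\<alpha> v \<noteq> 0" by auto
  have add: "\<alpha> (x + y) = \<alpha> x + \<alpha> y" and sc: "\<alpha> (scale c x) = c * \<alpha> x" for x y c
    using lin by (auto simp: Vector_Spaces.linear_iff)
  have sub: "subspace {x. \<alpha> x = 0}"
    using sc[of 0 0] by (auto simp: subspace_def add sc)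
  then have sp: "span {x. \<alpha> x = 0} = {x. \<alpha> x = 0}" by (simp add: span_eq_iff)
  have "x \<in> span (insert v {x. \<alpha> x = 0})" for x
  proof -
    have "\<alpha> (scale (\<alpha> x / \<alpha> v) v + (x - scale (\<alpha> x / \<alpha> v) v)) = \<alpha> x" by simp
    then have "\<alpha> (x - scale (\<alpha> x / \<alpha> v) v) = 0" using v by (simp only: add sc) simp
    then show ?thesis by (subst span_insert) (auto simp: sp)
  qed
  then have "span (insert v {x. \<alpha> x = 0}) = UNIV" by blast
  then have "dim (UNIV :: 'v set) = dim (insert v {x. \<alpha> x = 0})" by (metis dim_span)
  then show ?thesis
    unfolding homogeneous_hyperplane_def using sub v by (simp add: dim_insert sp)
qed

section \<open>Separating bihomogeneous functions\<close>

lemma poly_le_finite_span: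
  "\<exists>B. finite B \<and> (\<forall>q\<in>B. poly_le n d q) \<and>
    (\<forall>f. poly_le n d f \<longrightarrow> (\<exists>c. f = (\<lambda>x. \<Sum>q\<in>B. c q * q x)))"
proof (induction d)
  case 0
  have "\<exists>c. f = (\<lambda>x. \<Sum>q\<in>{\<lambda>_. 1}. c q * q x)" if f: "poly_le n 0 f"
    for f :: "(nat \<Rightarrow> 'a) \<Rightarrow> 'a"
  proof -
    obtain a where "f = (\<lambda>_. a)" using poly_le_0_const[OF f] by blast
    then show ?thesis by (intro exI[of _ "\<lambda>_. a"]) simp
  qed
  then show ?case
    by (intro exI[of _ "{\<lambda>_. 1}"] conjI) (auto intro: poly_le.const)
next
  case (Suc d)
  then obtain B :: "((nat \<Rightarrow> 'a) \<Rightarrow> 'a) set" where B: "finite B" "\<And>q. q \<in> B \<Longrightarrow> poly_le n d q"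
    "\<And>f. poly_le n d f \<Longrightarrow> \<exists>c. f = (\<lambda>x. \<Sum>q\<in>B. c q * q x)" by blast
  define m where "m = (\<lambda>i (q :: (nat \<Rightarrow> 'a) \<Rightarrow> 'a) x. x i * q x)"
  define B' where "B' = insert (\<lambda>_. 1) ((\<lambda>(i, q). m i q) ` ({..<n} \<times> B))"
  have fin: "finite B'" using B(1) by (simp add: B'_def)
  have B'_le: "poly_le n (Suc d) q" if q: "q \<in> B'" for q
  proof (cases "q = (\<lambda>_. 1)")
    case True
    then show ?thesis by (simp add: poly_le.const)
  next
    case False
    then obtain i p where ip: "i < n" "p \<in> B" "q = m i p" using q by (auto simp: B'_def)
    show ?thesis unfolding ip(3) m_def by (rule poly_le.var[OF ip(1) B(2)[OF ip(2)]])
  qed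
  have span: "\<exists>c. f = (\<lambda>x. \<Sum>q\<in>B'. c q * q x)" if "poly_le n D f" "D \<le> Suc d" for f D
    using that
  proof (induction rule: poly_le.induct)
    case (const D a)
    show ?case
    proof (intro exI[of _ "\<lambda>q. if q = (\<lambda>_. 1) then a else 0"] ext)
      fix x
      show "a = (\<Sum>q\<in>B'. (if q = (\<lambda>_. 1) then a else 0) * q x)"
        using fin by (simp add: if_distrib[of "\<lambda>u. u * _"] B'_def cong: if_cong)
    qed
  next
    case (var i D f)
    then have "poly_le n d f" using poly_le_mono[of n D f d n] by simp
    then obtain c where c: "f = (\<lambda>x. \<Sum>q\<in>B. c q * q x)" using B(3) by blast
    have mB': "m i q \<in> B'" if "q \<in> B" for q
      using that var(1) by (force simp: B'_def)
    \<comment> \<open>Different q may a priori give the same product, so the coefficients are summed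
      over the fibres of \<open>m i\<close>.\<close>
    define e where "e = (\<lambda>p. \<Sum>q | q \<in> B \<and> m i q = p. c q)"
    have "x i * f x = (\<Sum>p\<in>B'. e p * p x)" for x
    proof -
      have "(\<Sum>p\<in>B'. e p * p x) = (\<Sum>p\<in>B'. \<Sum>q | q \<in> B \<and> m i q = p. c q * m i q x)"
        by (auto simp: e_def sum_distrib_right intro!: sum.cong)
      also have "\<dots> = (\<Sum>q\<in>B. c q * m i q x)"
        using sum.group[OF B(1) fin, of "m i" "\<lambda>q. c q * m i q x"] mB' by blast
      finally show ?thesis
        by (simp add: c m_def sum_distrib_left mult.left_commute)
    qed
    then show ?case by blast
  next
    case (add D f g)
    then obtain c e where "f = (\<lambda>x. \<Sum>q\<in>B'. c q * q x)" "g = (\<lambda>x. \<Sum>q\<in>B'. e q * q x)"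
      by blast
    then show ?case
      by (intro exI[of _ "\<lambda>q. c q + e q"]) (simp add: distrib_right sum.distrib)
  qed
  show ?case
  proof (intro exI[of _ B'] conjI ballI allI impI)
    show "\<exists>c. f = (\<lambda>x. \<Sum>q\<in>B'. c q * q x)" if "poly_le n (Suc d) f" for f
      by (rule span[OF that order.refl])
  qed (fact fin, rule B'_le)
qed

text \<open>The matrix found so far is bordered by the next function h and a variable point x. If
  the new determinant is nonzero for some x in X, then h and x are added. If it vanishes on X, its
  expansion along the last column expresses h by the functions already chosen.\<close>

lemma exists_interpolation_points:
  fixes B :: "('p \<Rightarrow> 'k::field) set"
  assumes "finite B"
  shows "\<exists>m q z. (\<forall>j<m. q j \<in> B) \<and> (\<forall>i<m. z i \<in> X) \<and> det (mat m m (\<lambda>(i, j). q i (z j))) \<noteq> 0 \<and>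
    (\<forall>f\<in>B. \<exists>c. \<forall>x\<in>X. f x = (\<Sum>i<m. c i * q i x))"
  using assms
proof (induction B)
  case empty
  show ?case by (intro exI[of _ 0]) simp
next
  case (insert h B)
  then obtain m q z where q: "\<And>j. j < m \<Longrightarrow> q j \<in> B" "\<And>i. i < m \<Longrightarrow> z i \<in> X"
    and det: "det (mat m m (\<lambda>(i, j). q i (z j))) \<noteq> 0"
    and span: "\<And>f. f \<in> B \<Longrightarrow> \<exists>c. \<forall>x\<in>X. f x = (\<Sum>i<m. c i * q i x)" by blast
  define q' where "q' = q(m := h)"
  define A where "A = (\<lambda>x. mat (Suc m) (Suc m) (\<lambda>(i, j). q' i ((z(m := x)) j)))"
  have A: "A x \<in> carrier_mat (Suc m) (Suc m)" for x by (simp add: A_def)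
  \<comment> \<open>Only the last column depends on x, so its cofactors do not, and
    \<open>undefined\<close> stands for any point.\<close>
  define e where "e = (\<lambda>i. cofactor (A undefined) i m)"
  have "cofactor (A x) i m = e i" if "i < Suc m" for i x
  proof -
    have "mat_delete (A x) i m = mat_delete (A undefined) i m"
      using that by (intro eq_matI) (auto simp: A_def mat_delete_def)
    then show ?thesis by (simp add: e_def cofactor_def)
  qed
  then have lap: "det (A x) = (\<Sum>i<Suc m. q' i x * e i)" for x
    using laplace_expansion_column[OF A, of m x] by (simp add: A_def)
  have em: "e m \<noteq> 0"
  proof -
    have "mat_delete (A undefined) m m = mat m m (\<lambda>(i, j). q i (z j))"
      by (rule eq_matI) (auto simp: A_def mat_delete_def q'_def)
    then show ?thesis using det by (simp add: e_def cofactor_def)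
  qed
  show ?case
  proof (cases "\<exists>x\<in>X. det (A x) \<noteq> 0")
    case True
    then obtain x where x: "x \<in> X" "det (A x) \<noteq> 0" by blast
    have "\<exists>c. \<forall>y\<in>X. f y = (\<Sum>i<Suc m. c i * q' i y)" if f: "f \<in> insert h B" for f
    proof (cases "f = h")
      case True
      then show ?thesis
        by (intro exI[of _ "\<lambda>i. if i = m then 1 else 0"]) (simp add: q'_def)
    next
      case False
      then obtain c where "\<forall>y\<in>X. f y = (\<Sum>i<m. c i * q i y)" using span f by blast
      then show ?thesis
        by (intro exI[of _ "c(m := 0)"]) (simp add: q'_def)
    qed
    then show ?thesis using x q
      by (intro exI[of _ "Suc m"] exI[of _ q'] exI[of _ "z(m := x)"])
        (auto simp: A_def q'_def less_Suc_eq)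
  next
    case False
    have "h x = (\<Sum>i<m. (- e i / e m) * q i x)" if "x \<in> X" for x
    proof -
      have "(\<Sum>i<m. q i x * e i) + h x * e m = 0"
        using False lap[of x] that by (simp add: q'_def)
      then have "h x = - (\<Sum>i<m. q i x * e i) / e m"
        using em by (simp add: field_simps eq_neg_iff_add_eq_0)
      then show ?thesis by (simp add: sum_divide_distrib sum_negf mult.commute)
    qed
    then have "\<exists>c. \<forall>x\<in>X. h x = (\<Sum>i<m. c i * q i x)"
      by (intro exI[of _ "\<lambda>i. - e i / e m"] ballI)
    then have "\<exists>c. \<forall>x\<in>X. f x = (\<Sum>i<m. c i * q i x)" if "f \<in> insert h B" for f
      using span that by blast
    then show ?thesis using q det by (intro exI[of _ m] exI[of _ q] exI[of _ z]) auto
  qed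
qed

section \<open>Bihomogeneous functions\<close>

lemma bihom_cmult: "bihom d e f \<Longrightarrow> bihom d e (\<lambda>\<alpha> \<beta>. c * f \<alpha> \<beta>)"
  using bihom.mult[OF bihom.const[of c]] by fastforce

text \<open>\<open>f\<^sub>0\<close> provides the zero function in bidegree (d, e), as
  \<open>0 * f\<^sub>0\<close>, for the empty sum.\<close>

lemma bihom_sum:
  fixes f :: "'a \<Rightarrow> ('v \<Rightarrow> 'k::field) \<Rightarrow> ('v \<Rightarrow> 'k) \<Rightarrow> 'k"
    and f\<^sub>0 :: "('v \<Rightarrow> 'k) \<Rightarrow> ('v \<Rightarrow> 'k) \<Rightarrow> 'k"
  assumes "bihom d e f\<^sub>0" "\<And>i. i \<in> A \<Longrightarrow> bihom d e (f i)"
  shows "bihom d e (\<lambda>\<alpha> \<beta>. \<Sum>i\<in>A. f i \<alpha> \<beta>)"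
  using assms(2) bihom_cmult[OF assms(1), of 0]
  by (induction A rule: infinite_finite_induct) (auto intro: bihom.add)

lemma bihom_power: "bihom d e f \<Longrightarrow> bihom (k * d) (k * e) (\<lambda>\<alpha> \<beta>. f \<alpha> \<beta> ^ k)"
  by (induction k) (auto intro: bihom.const bihom.mult)

lemma bihom_prod:
  "(\<And>i. i < m \<Longrightarrow> bihom d e (f i)) \<Longrightarrow> bihom (m * d) (m * e) (\<lambda>\<alpha> \<beta>. \<Prod>i<m. f i \<alpha> \<beta>)"
proof (induction m)
  case (Suc m)
  then show ?case
    using bihom.mult[of "m * d" "m * e" "\<lambda>\<alpha> \<beta>. \<Prod>i<m. f i \<alpha> \<beta>" d e "f m"] by (simp add: add.commute)
qed (auto intro: bihom.const)

text \<open>Each term of the Leibniz formula takes one entry from every row: m entries linear in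
  \<alpha> and one of degree K in \<beta>.\<close>

lemma bihom_bordered_det:
  fixes f :: "nat \<Rightarrow> nat \<Rightarrow> ('v \<Rightarrow> 'k::field) \<Rightarrow> ('v \<Rightarrow> 'k) \<Rightarrow> 'k"
  assumes "\<And>i j. i < m \<Longrightarrow> bihom 1 0 (f i j)" "\<And>j. bihom 0 K (f m j)"
  shows "bihom m K (\<lambda>\<alpha> \<beta>. det (mat (Suc m) (Suc m) (\<lambda>(i, j). f i j \<alpha> \<beta>)))"
proof -
  have eq: "det (mat (Suc m) (Suc m) (\<lambda>(i, j). f i j \<alpha> \<beta>)) =
      (\<Sum>p\<in>{p. p permutes {0..<Suc m}}. of_int (sign p) * ((\<Prod>i<m. f i (p i) \<alpha> \<beta>) * f m (p m) \<alpha> \<beta>))" for \<alpha> \<beta>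
  proof -
    have "(\<Prod>i=0..<Suc m. mat (Suc m) (Suc m) (\<lambda>(i, j). f i j \<alpha> \<beta>) $$ (i, p i)) =
        (\<Prod>i<m. f i (p i) \<alpha> \<beta>) * f m (p m) \<alpha> \<beta>" if "p permutes {0..<Suc m}" for p
    proof -
      have "p i < Suc m" if "i < Suc m" for i
        using permutes_in_image[OF \<open>p permutes {0..<Suc m}\<close>, of i] that by simp
      then have "(\<Prod>i=0..<Suc m. mat (Suc m) (Suc m) (\<lambda>(i, j). f i j \<alpha> \<beta>) $$ (i, p i)) =
          (\<Prod>i=0..<Suc m. f i (p i) \<alpha> \<beta>)"
        by (intro prod.cong) auto
      then show ?thesis by (simp add: atLeast0LessThan)
    qed
    then show ?thesis by (auto simp: det_def intro!: sum.cong)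
  qed
  have summand: "bihom m K (\<lambda>\<alpha> \<beta>. (\<Prod>i<m. f i (p i) \<alpha> \<beta>) * f m (p m) \<alpha> \<beta>)" for p
    using bihom.mult[OF bihom_prod[of m 1 0 "\<lambda>i. f i (p i)"] assms(2)[of "p m"]] assms(1) by simp
  show ?thesis unfolding eq
    by (rule bihom_sum[OF summand[of id]]) (rule bihom_cmult[OF summand])
qed

lemma bihom_swap: "bihom d e f \<Longrightarrow> bihom e d (\<lambda>\<alpha> \<beta>. f \<beta> \<alpha>)"
  by (induction rule: bihom.induct) (auto intro: bihom.intros[unfolded One_nat_def])

text \<open>The zero sets of f and h cut out two closed subsets that cover X.\<close>

lemma irreducible_zariski_no_zero_divisors:
  assumes "irreducible_space (subtopology (zariski scale) X)"
    and "f \<in> polyfuns scale" "h \<in> polyfuns scale" "\<And>x. x \<in> X \<Longrightarrow> f x * h x = 0"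
  shows "(\<forall>x\<in>X. f x = 0) \<or> (\<forall>x\<in>X. h x = 0)"
proof -
  let ?T = "subtopology (zariski scale) X"
  have cl: "closedin ?T (X \<inter> {x. u x = 0})" if "u \<in> polyfuns scale" for u
    unfolding closedin_subtopology closedin_zariski
    by (intro exI[of _ "{x. u x = 0}"] conjI exI[of _ "{u}"]) (use that in auto)
  have top: "topspace ?T = X" by simp
  have "(X \<inter> {x. f x = 0}) \<union> (X \<inter> {x. h x = 0}) = topspace ?T"
    using assms(4) by auto
  then have "X \<inter> {x. f x = 0} = X \<or> X \<inter> {x. h x = 0} = X"
    using assms(1) cl[OF assms(2)] cl[OF assms(3)] unfolding irreducible_space_def top by meson
  then show ?thesis by blast
qed

text \<open>
  \<open>A\<close> tests on finitely many points whether \<open>(g * \<beta>)^K\<close> depends linearly on \<open>\<alpha> * P\<close>: the first \<open>m\<close>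
  points are interpolation points for \<open>\<alpha>\<^sub>0 * P\<close>, the last one is \<open>x\<^sub>0\<close>.
\<close>

lemma (in coordinates) separating_bihom:
  assumes X: "algebraic_subvariety scale X" and irr: "irreducible_space (subtopology (zariski scale) X)"
    and \<alpha>\<^sub>0: "\<alpha>\<^sub>0 \<in> dual scale" "\<exists>x\<in>X. \<alpha>\<^sub>0 x \<noteq> 0" and \<beta>\<^sub>0: "\<beta>\<^sub>0 \<in> dual scale"
    and x\<^sub>0: "x\<^sub>0 \<in> X" "\<alpha>\<^sub>0 x\<^sub>0 = 0" "\<beta>\<^sub>0 x\<^sub>0 \<noteq> 0"
  shows "\<exists>f\<in>bihoms. f \<alpha>\<^sub>0 \<beta>\<^sub>0 \<noteq> 0 \<and> (\<forall>\<alpha>\<in>dual scale. \<forall>\<beta>\<in>dual scale.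
    (\<forall>x\<in>X. \<alpha> x = 0 \<longrightarrow> \<beta> x = 0) \<longrightarrow> f \<alpha> \<beta> = 0)"
proof -
  obtain U C where UC: "openin (zariski scale) U" "closedin (zariski scale) C" "X = U \<inter> C"
    using X unfolding algebraic_subvariety_def locally_closedin_def by blast
  obtain F where F: "F \<subseteq> polyfuns scale" "U = (\<Union>f\<in>F. {x. f x \<noteq> 0})"
    using UC(1) unfolding openin_zariski by blast
  obtain g where g: "g \<in> F" "g x\<^sub>0 \<noteq> 0" using x\<^sub>0(1) UC(3) F(2) by blast
  have gp: "g \<in> polyfuns scale" using g(1) F(1) by blast
  obtain K M where K: "0 < K" and KM: "\<And>\<alpha> \<beta>. \<alpha> \<in> dual scale \<Longrightarrow> \<beta> \<in> dual scale \<Longrightarrow>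
      \<forall>x\<in>C. \<alpha> x = 0 \<longrightarrow> g x * \<beta> x = 0 \<Longrightarrow>
      \<exists>Q. poly_le r M Q \<and> (\<forall>x\<in>C. (g x * \<beta> x) ^ K = \<alpha> x * Q (coords x))"
    using uniform_divisibility[OF UC(2) gp] by blast
  obtain B :: "((nat \<Rightarrow> 'k) \<Rightarrow> 'k) set" where B: "finite B" "\<And>q. q \<in> B \<Longrightarrow> poly_le r M q"
    "\<And>f. poly_le r M f \<Longrightarrow> \<exists>c. f = (\<lambda>x. \<Sum>q\<in>B. c q * q x)"
    using poly_le_finite_span[of r M] by blast
  define E where "E = (\<lambda>q x. \<alpha>\<^sub>0 x * q (coords x)) ` B"
  have "finite E" using B(1) by (simp add: E_def)
  from exists_interpolation_points[OF this, of X]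
  obtain m q' z where q': "\<And>j. j < m \<Longrightarrow> q' j \<in> E" and z: "\<And>i. i < m \<Longrightarrow> z i \<in> X"
    and det: "det (mat m m (\<lambda>(i, j). q' i (z j))) \<noteq> 0"
    and span: "\<And>f. f \<in> E \<Longrightarrow> \<exists>c. \<forall>x\<in>X. f x = (\<Sum>i<m. c i * q' i x)"
    by blast
  have "\<exists>p\<in>B. q' j = (\<lambda>x. \<alpha>\<^sub>0 x * p (coords x))" if "j < m" for j
    using q'[OF that] by (auto simp: E_def)
  then obtain q where q: "\<And>j. j < m \<Longrightarrow> q j \<in> B"
    "\<And>j. j < m \<Longrightarrow> q' j = (\<lambda>x. \<alpha>\<^sub>0 x * q j (coords x))" by metis
  \<comment> \<open>A relation between the multiples of \<open>\<alpha>\<^sub>0\<close> on X can be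
    divided by \<open>\<alpha>\<^sub>0\<close>. So the functions q i span the bounded degree
    polynomials on X, and they can be used with every \<alpha>.\<close>
  have spanB: "\<exists>c. \<forall>x\<in>X. p (coords x) = (\<Sum>i<m. c i * q i (coords x))" if p: "p \<in> B" for p
  proof -
    have "(\<lambda>x. \<alpha>\<^sub>0 x * p (coords x)) \<in> E" using p by (auto simp: E_def)
    then obtain c where c: "\<And>x. x \<in> X \<Longrightarrow> \<alpha>\<^sub>0 x * p (coords x) = (\<Sum>i<m. c i * q' i x)"
      using span by blast
    define h where "h = (\<lambda>y. p y - (\<Sum>i<m. c i * q i y))"
    have "poly_le r M h"
      unfolding h_def using B(2) p q(1)
      by (intro poly_le_diff poly_le_sum poly_le_cmult) auto
    then have "(\<lambda>x. h (coords x)) \<in> polyfuns scale" by (rule poly_le_imp_polyfuns)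
    moreover have "\<alpha>\<^sub>0 x * h (coords x) = 0" if "x \<in> X" for x
      using c[OF that] q(2) by (simp add: h_def right_diff_distrib sum_distrib_left mult.left_commute)
    ultimately have "\<forall>x\<in>X. h (coords x) = 0"
      using irreducible_zariski_no_zero_divisors[OF irr polyfuns.functional[OF \<alpha>\<^sub>0(1)]] \<alpha>\<^sub>0(2)
      by blast
    then show ?thesis by (intro exI[of _ c]) (simp add: h_def)
  qed
  define f where "f = (\<lambda>i j \<alpha> \<beta>. if i < m then \<alpha> ((z(m := x\<^sub>0)) j) * q i (coords ((z(m := x\<^sub>0)) j))
      else (g ((z(m := x\<^sub>0)) j) * \<beta> ((z(m := x\<^sub>0)) j)) ^ K)"
  define A where "A = (\<lambda>\<alpha> \<beta>. mat (Suc m) (Suc m) (\<lambda>(i, j). f i j \<alpha> \<beta>))"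
  have A: "A \<alpha> \<beta> \<in> carrier_mat (Suc m) (Suc m)" for \<alpha> \<beta> by (simp add: A_def)
  have zX: "(z(m := x\<^sub>0)) j \<in> X" if "j < Suc m" for j using z x\<^sub>0(1) that by auto
  have "bihom m K (\<lambda>\<alpha> \<beta>. det (A \<alpha> \<beta>))"
    unfolding A_def
  proof (rule bihom_bordered_det)
    fix i j assume "i < m"
    then show "bihom 1 0 (f i j)"
      using bihom_cmult[OF bihom.eval1[of "(z(m := x\<^sub>0)) j"], of "q i (coords ((z(m := x\<^sub>0)) j))"]
      by (simp add: f_def mult.commute)
  next
    fix j
    show "bihom 0 K (f m j)"
      using bihom_power[OF bihom_cmult[OF bihom.eval2[of "(z(m := x\<^sub>0)) j"], of "g ((z(m := x\<^sub>0)) j)"], of K]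
      by (simp add: f_def)
  qed
  then have "(\<lambda>\<alpha> \<beta>. det (A \<alpha> \<beta>)) \<in> bihoms" by (auto simp: bihoms_def)
  \<comment> \<open>As \<open>\<alpha>\<^sub>0 x\<^sub>0 = 0\<close>, the last column is zero except
    for its bottom entry, whose complementary minor is the interpolation determinant.\<close>
  moreover have "det (A \<alpha>\<^sub>0 \<beta>\<^sub>0) \<noteq> 0"
  proof -
    have "det (A \<alpha>\<^sub>0 \<beta>\<^sub>0) = (\<Sum>i<Suc m. A \<alpha>\<^sub>0 \<beta>\<^sub>0 $$ (i, m) * cofactor (A \<alpha>\<^sub>0 \<beta>\<^sub>0) i m)"
      by (rule laplace_expansion_column[OF A]) simp
    also have "\<dots> = (g x\<^sub>0 * \<beta>\<^sub>0 x\<^sub>0) ^ K * cofactor (A \<alpha>\<^sub>0 \<beta>\<^sub>0) m m"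
      by (simp add: A_def f_def x\<^sub>0(2))
    also have "mat_delete (A \<alpha>\<^sub>0 \<beta>\<^sub>0) m m = mat m m (\<lambda>(i, j). q' i (z j))"
      by (rule eq_matI) (auto simp: A_def mat_delete_def f_def q(2))
    then have "cofactor (A \<alpha>\<^sub>0 \<beta>\<^sub>0) m m \<noteq> 0" using det by (simp add: cofactor_def)
    ultimately show ?thesis using g(2) x\<^sub>0(3) by simp
  qed
  moreover have "det (A \<alpha> \<beta>) = 0"
    if ab: "\<alpha> \<in> dual scale" "\<beta> \<in> dual scale" and Ch: "\<forall>x\<in>X. \<alpha> x = 0 \<longrightarrow> \<beta> x = 0" for \<alpha> \<beta>
  proof -
    \<comment> \<open>A point of C where g is nonzero lies in U, hence in X.\<close>
    have "\<forall>x\<in>C. \<alpha> x = 0 \<longrightarrow> g x * \<beta> x = 0" using Ch UC(3) F(2) g(1) by auto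
    then obtain Q where Q: "poly_le r M Q" "\<And>x. x \<in> C \<Longrightarrow> (g x * \<beta> x) ^ K = \<alpha> x * Q (coords x)"
      using KM[OF ab] by blast
    obtain c where c: "Q = (\<lambda>y. \<Sum>p\<in>B. c p * p y)" using B(3)[OF Q(1)] by blast
    obtain e where e: "\<And>p x. p \<in> B \<Longrightarrow> x \<in> X \<Longrightarrow> p (coords x) = (\<Sum>i<m. e p i * q i (coords x))"
      using spanB by metis
    define w where "w = (\<lambda>i. \<Sum>p\<in>B. c p * e p i)"
    have "Q (coords x) = (\<Sum>i<m. w i * q i (coords x))" if "x \<in> X" for x
    proof -
      have "Q (coords x) = (\<Sum>p\<in>B. \<Sum>i<m. c p * e p i * q i (coords x))"
        unfolding c
      proof (rule sum.cong[OF refl])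
        fix p assume p: "p \<in> B"
        show "c p * p (coords x) = (\<Sum>i<m. c p * e p i * q i (coords x))"
          by (subst e[OF p that]) (simp add: sum_distrib_left mult.assoc)
      qed
      also have "\<dots> = (\<Sum>i<m. \<Sum>p\<in>B. c p * e p i * q i (coords x))" by (rule sum.swap)
      finally show ?thesis by (simp add: w_def sum_distrib_right)
    qed
    then have row: "(g x * \<beta> x) ^ K = (\<Sum>i<m. w i * (\<alpha> x * q i (coords x)))" if "x \<in> X" for x
      using that Q(2)[of x] UC(3) by (simp add: sum_distrib_left mult.left_commute)
    \<comment> \<open>The last row is the combination of the first m rows with coefficients w; the
      entry -1 makes this a nonzero kernel vector of the transpose.\<close>
    define v where "v = vec (Suc m) (\<lambda>i. if i = m then -1 else w i)"
    have "transpose_mat (A \<alpha> \<beta>) *\<^sub>v v = 0\<^sub>v (Suc m)"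
    proof (rule eq_vecI)
      fix j assume "j < dim_vec (0\<^sub>v (Suc m))"
      then have j: "j < Suc m" by simp
      have "(transpose_mat (A \<alpha> \<beta>) *\<^sub>v v) $ j = (\<Sum>i<Suc m. f i j \<alpha> \<beta> * (if i = m then -1 else w i))"
        using j by (auto simp: A_def v_def scalar_prod_def atLeast0LessThan intro!: sum.cong)
      also have "\<dots> = 0"
        using row[OF zX[OF j]] by (simp add: f_def mult.commute)
      finally show "(transpose_mat (A \<alpha> \<beta>) *\<^sub>v v) $ j = 0\<^sub>v (Suc m) $ j" using j by simp
    qed (simp add: A_def)
    moreover have "v \<in> carrier_vec (Suc m)" by (simp add: v_def)
    moreover have "v \<noteq> 0\<^sub>v (Suc m)"
    proof
      assume "v = 0\<^sub>v (Suc m)"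
      then have "v $ m = 0" by simp
      then show False by (simp add: v_def)
    qed
    ultimately have "det (transpose_mat (A \<alpha> \<beta>)) = 0"
      using det_0_iff_vec_prod_zero_field[of "transpose_mat (A \<alpha> \<beta>)" "Suc m"] A by auto
    then show ?thesis by (simp add: det_transpose[OF A])
  qed
  ultimately show ?thesis by (intro bexI[of _ "\<lambda>\<alpha> \<beta>. det (A \<alpha> \<beta>)"]) auto
qed

text \<open>The set is cut out by all bihomogeneous functions vanishing on it, so one separating
  function for each pair outside is enough.\<close>

lemma closedin_zariski_proj2I:
  assumes "\<And>\<alpha> \<beta>. \<alpha> \<in> nonzero_dual scale \<Longrightarrow> \<beta> \<in> nonzero_dual scale \<Longrightarrow> \<not> P \<alpha> \<beta> \<Longrightarrow>
    \<exists>f\<in>bihoms. f \<alpha> \<beta> \<noteq> 0 \<and>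
      (\<forall>\<alpha>'\<in>nonzero_dual scale. \<forall>\<beta>'\<in>nonzero_dual scale. P \<alpha>' \<beta>' \<longrightarrow> f \<alpha>' \<beta>' = 0)"
  shows "closedin (zariski_proj2 scale) {(proj_point \<alpha>, proj_point \<beta>) | \<alpha> \<beta>.
    \<alpha> \<in> nonzero_dual scale \<and> \<beta> \<in> nonzero_dual scale \<and> P \<alpha> \<beta>}"
proof -
  define F where "F = {f\<in>bihoms. \<forall>\<alpha>\<in>nonzero_dual scale. \<forall>\<beta>\<in>nonzero_dual scale. P \<alpha> \<beta> \<longrightarrow> f \<alpha> \<beta> = 0}"
  have "P \<alpha> \<beta> \<longleftrightarrow> (\<forall>f\<in>F. f \<alpha> \<beta> = 0)"
    if "\<alpha> \<in> nonzero_dual scale" "\<beta> \<in> nonzero_dual scale" for \<alpha> \<beta>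
    using assms[OF that] that unfolding F_def by blast
  then have "{(proj_point \<alpha>, proj_point \<beta>) | \<alpha> \<beta>.
      \<alpha> \<in> nonzero_dual scale \<and> \<beta> \<in> nonzero_dual scale \<and> P \<alpha> \<beta>} =
    {(proj_point \<alpha>, proj_point \<beta>) | \<alpha> \<beta>.
      \<alpha> \<in> nonzero_dual scale \<and> \<beta> \<in> nonzero_dual scale \<and> (\<forall>f\<in>F. f \<alpha> \<beta> = 0)}"
    by (intro Collect_cong) metis
  moreover have "F \<subseteq> bihoms" by (auto simp: F_def)
  ultimately show ?thesis unfolding closedin_zariski_proj2 by blast
qed

theorem theorem2:
  fixes scale :: "'k::alg_closed_field \<Rightarrow> 'v::ab_group_add \<Rightarrow> 'v"
    and Basis :: "'v set"
    and X :: "'v set"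
  assumes "finite_dimensional_vector_space scale Basis"
    and "algebraic_subvariety scale X"
    and "irreducible_space (subtopology (zariski scale) X)"
    and "\<nexists>H. homogeneous_hyperplane scale H \<and> X \<subseteq> H"
    and "\<forall>H. homogeneous_hyperplane scale H \<longrightarrow> X \<inter> H \<noteq> {}"
    and "krull_dim (subtopology (zariski scale) X) > 1"
  shows "closedin (zariski_proj2 scale) (Ch scale X) \<and>
         closedin (zariski_proj2 scale) (Chw scale X)"
proof -
  obtain r b \<phi> where "coordinates scale r b \<phi>" using exists_coordinates[OF assms(1)] by blast
  then interpret coordinates scale r b \<phi> .
  have sep: "\<exists>f\<in>bihoms. f \<alpha> \<beta> \<noteq> 0 \<and> (\<forall>\<alpha>'\<in>nonzero_dual scale. \<forall>\<beta>'\<in>nonzero_dual scale.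
      (\<forall>x\<in>X. \<alpha>' x = 0 \<longrightarrow> \<beta>' x = 0) \<longrightarrow> f \<alpha>' \<beta>' = 0)"
    if ab: "\<alpha> \<in> nonzero_dual scale" "\<beta> \<in> nonzero_dual scale"
      and x: "x \<in> X" "\<alpha> x = 0" "\<beta> x \<noteq> 0" for \<alpha> \<beta> x
  proof -
    \<comment> \<open>The kernel of \<alpha> is a homogeneous hyperplane, so it does not contain
      X.\<close>
    have "\<exists>x\<in>X. \<alpha> x \<noteq> 0"
      using homogeneous_hyperplane_kernel[OF assms(1) ab(1)] assms(4) by blast
    moreover have "\<alpha> \<in> dual scale" "\<beta> \<in> dual scale" using ab by (auto simp: nonzero_dual_def)
    ultimately obtain f where "f \<in> bihoms" "f \<alpha> \<beta> \<noteq> 0" "\<forall>\<alpha>\<in>dual scale. \<forall>\<beta>\<in>dual scale.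
        (\<forall>x\<in>X. \<alpha> x = 0 \<longrightarrow> \<beta> x = 0) \<longrightarrow> f \<alpha> \<beta> = 0"
      using separating_bihom[OF assms(2,3), of \<alpha> \<beta> x] x by blast
    then show ?thesis unfolding nonzero_dual_def by blast
  qed
  show ?thesis
  proof
    show "closedin (zariski_proj2 scale) (Ch scale X)"
      unfolding Ch_def by (rule closedin_zariski_proj2I) (use sep in blast)
    show "closedin (zariski_proj2 scale) (Chw scale X)"
      unfolding Chw_def
    proof (rule closedin_zariski_proj2I)
      fix \<alpha> \<beta> assume ab: "\<alpha> \<in> nonzero_dual scale" "\<beta> \<in> nonzero_dual scale"
        and "\<not> (\<forall>x\<in>X. (\<alpha> x = 0) = (\<beta> x = 0))"
      then obtain x where "x \<in> X" "\<alpha> x = 0 \<and> \<beta> x \<noteq> 0 \<or> \<beta> x = 0 \<and> \<alpha> x \<noteq> 0" by blast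
      then show "\<exists>f\<in>bihoms. f \<alpha> \<beta> \<noteq> 0 \<and> (\<forall>\<alpha>'\<in>nonzero_dual scale. \<forall>\<beta>'\<in>nonzero_dual scale.
          (\<forall>x\<in>X. (\<alpha>' x = 0) = (\<beta>' x = 0)) \<longrightarrow> f \<alpha>' \<beta>' = 0)"
      proof (elim disjE conjE)
        assume "\<alpha> x = 0" "\<beta> x \<noteq> 0"
        from sep[OF ab \<open>x \<in> X\<close> this] obtain f where f: "f \<in> bihoms"
          "f \<alpha> \<beta> \<noteq> 0 \<and> (\<forall>\<alpha>'\<in>nonzero_dual scale. \<forall>\<beta>'\<in>nonzero_dual scale.
             (\<forall>x\<in>X. \<alpha>' x = 0 \<longrightarrow> \<beta>' x = 0) \<longrightarrow> f \<alpha>' \<beta>' = 0)" by (rule bexE)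
        then show ?thesis by (intro bexI[of _ f]) auto
      next
        \<comment> \<open>The function separating (\<beta>, \<alpha>) is read with its arguments
          exchanged; on pairs of Chw(X) the implication holds in both directions.\<close>
        assume "\<beta> x = 0" "\<alpha> x \<noteq> 0"
        from sep[OF ab(2,1) \<open>x \<in> X\<close> this] obtain f where f: "f \<in> bihoms"
          "f \<beta> \<alpha> \<noteq> 0 \<and> (\<forall>\<alpha>'\<in>nonzero_dual scale. \<forall>\<beta>'\<in>nonzero_dual scale.
             (\<forall>x\<in>X. \<alpha>' x = 0 \<longrightarrow> \<beta>' x = 0) \<longrightarrow> f \<alpha>' \<beta>' = 0)" by (rule bexE)
        have "(\<lambda>\<alpha> \<beta>. f \<beta> \<alpha>) \<in> bihoms" using f(1) bihom_swap unfolding bihoms_def by blast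
        then show ?thesis using f(2) by (intro bexI[of _ "\<lambda>\<alpha> \<beta>. f \<beta> \<alpha>"]) auto
      qed
    qed
  qed
qed

end
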